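(* Let $\mu_\infty$ be the measure on $[0,1]^2$ defined by \[ \int\alpha\,d\mu_\infty=\frac12\int_0^1\Big\{\alpha\big(x,\tfrac{x}{2}\big)+\alpha\big(x,\tfrac12+\tfrac x2\big)\Big\}\,dx\qquad\text{for all }\alpha\in C^0([0,1]^2), \] and for every integer $n\ge1$ let $\mu_n$ be the measure on $[0,1]^2$ defined by \[ \int\alpha\,d\mu_n=\sum_{i=0}^{n-1}\int_0^{1/(2n)}\Big\{\alpha\big(\tfrac in+x,\tfrac{i}{2n}+x\big)+\alpha\big(\tfrac{2i+1}{2n}+x,\tfrac12+\tfrac{i}{2n}+x\big)\Big\}\,dx\qquad\text{for all }\alpha\in C^0([0,1]^2). \] Then $\mu_n\to\mu_\infty$ narrowly as $n\to\infty$, and \[ \liminf_{n\to\infty}\overline{\mathcal{A}}(\mu_\infty,\mu_n)\ \ge\ \frac1{16}\ >\ 0\ =\ \overline{\mathcal{A}}(\mu_\infty,\mu_\infty). \] In particular, $\overline{\mathcal{A}}(\mu_\infty,\cdot)$ is not continuous for the narrow convergence of bistochastic measures.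
   Context: The extended (Ambrosio-Figalli) model on the domain $D=[0,1]$: a bistochastic measure is a positive Borel measure on $D\times D$ both of whose marginals are the Lebesgue measure $\lambda$ on $D$. Let $\mathcal{C}=C^0([0,1];D)$ and $\overline{\mathcal{C}}=D\times\mathcal{C}$, whose elements are written $(a,\omega)$. A flow is a (positive) Borel measure $H$ on $\overline{\mathcal{C}}$. Its action is \[ \overline{\mathcal{A}}(H)=\int\frac12\int_0^1|\dot\omega(t)|^2\,dt\,dH(a,\omega), \] where the inner action of $\omega$ is set to $+\infty$ if $\omega$ is not absolutely continuous. Given bistochastic measures $\mu,\nu$, a flow $H$ is admissible for $\overline{\mathsf{Pb}}(\mu,\nu)$ if the law of $\omega(t)$ under $H$ is $\lambda$ for every $t\in[0,1]$, $\overline{\mathcal{A}}(H)<+\infty$, the law of $(a,\omega(0))$ under $H$ is $\mu$, and the law of $(a,\omega(1))$ under $H$ is $\nu$. $\overline{\mathcal{A}}(\mu,\nu)$ denotes the optimal action, i.e. the infimum of $\overline{\mathcal{A}}(H)$ over all admissible flows $H$. *)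

theory Defs
  imports "HOL-Analysis.Analysis"
begin

definition D :: "real set" where
  "D = {0..1}"

definition lebesgue_D :: "real measure" where
  "lebesgue_D = restrict_space lborel D"

definition borel_square :: "(real \<times> real) measure" where
  "borel_square = restrict_space borel (D \<times> D)"

definition bistochastic :: "(real \<times> real) measure \<Rightarrow> bool" where
  "bistochastic \<mu> \<longleftrightarrow>
     sets \<mu> = sets borel_square \<and>
     distr \<mu> lebesgue_D fst = lebesgue_D \<and>
     distr \<mu> lebesgue_D snd = lebesgue_D"

text \<open>
  The space of continuous paths from \<open>[0,1]\<close> to \<open>D\<close> with the uniform distance. Its points are
  functions on the reals that take the value \<open>undefined\<close> outside \<open>[0,1]\<close>.
\<close>

definition path_metric :: "(real \<Rightarrow> real) metric" where
  "path_metric = cfunspace (top_of_set {0..1}) (submetric euclidean_metric D)"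

definition marked_path_topology :: "(real \<times> (real \<Rightarrow> real)) topology" where
  "marked_path_topology = prod_topology (top_of_set D) (mtopology_of path_metric)"

definition borel_of_topology :: "'a topology \<Rightarrow> 'a measure" where
  "borel_of_topology T = sigma (topspace T) {U. openin T U}"

definition flow :: "(real \<times> (real \<Rightarrow> real)) measure \<Rightarrow> bool" where
  "flow H \<longleftrightarrow> sets H = sets (borel_of_topology marked_path_topology)"

definition absolutely_continuous_fun :: "real \<Rightarrow> real \<Rightarrow> (real \<Rightarrow> real) \<Rightarrow> bool" where
  "absolutely_continuous_fun a b f \<longleftrightarrow>
     (\<forall>\<epsilon>>0. \<exists>\<delta>>0. \<forall>I :: (real \<times> real) set.
        finite I \<longrightarrow>
        (\<forall>(u, v)\<in>I. a \<le> u \<and> u \<le> v \<and> v \<le> b) \<longrightarrow>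
        disjoint_family_on (\<lambda>(u, v). {u<..<v}) I \<longrightarrow>
        (\<Sum>(u, v)\<in>I. v - u) < \<delta> \<longrightarrow>
        (\<Sum>(u, v)\<in>I. \<bar>f v - f u\<bar>) < \<epsilon>)"

text \<open>
  An absolutely continuous path is differentiable almost everywhere, so the unspecified value of
  \<open>deriv\<close> at points of non-differentiability (and at the end points, where the path is the
  restriction of a function that is \<open>undefined\<close> on one side) does not affect the integral.
\<close>

definition path_action :: "(real \<Rightarrow> real) \<Rightarrow> ennreal" where
  "path_action \<omega> =
     (if absolutely_continuous_fun 0 1 \<omega>
      then (\<integral>\<^sup>+ t\<in>{0..1}. ennreal (1/2 * \<bar>deriv \<omega> t\<bar>\<^sup>2) \<partial>lborel)
      else \<infinity>)"

definition flow_action :: "(real \<times> (real \<Rightarrow> real)) measure \<Rightarrow> ennreal" where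
  "flow_action H = (\<integral>\<^sup>+ (a, \<omega>). path_action \<omega> \<partial>H)"

definition admissible ::
  "(real \<times> real) measure \<Rightarrow> (real \<times> real) measure \<Rightarrow>
   (real \<times> (real \<Rightarrow> real)) measure \<Rightarrow> bool" where
  "admissible \<mu> \<nu> H \<longleftrightarrow>
     flow H \<and>
     (\<forall>t\<in>{0..1}. distr H lebesgue_D (\<lambda>(a, \<omega>). \<omega> t) = lebesgue_D) \<and>
     flow_action H < \<infinity> \<and>
     distr H borel_square (\<lambda>(a, \<omega>). (a, \<omega> 0)) = \<mu> \<and>
     distr H borel_square (\<lambda>(a, \<omega>). (a, \<omega> 1)) = \<nu>"

definition optimal_action ::
  "(real \<times> real) measure \<Rightarrow> (real \<times> real) measure \<Rightarrow> ennreal" where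
  "optimal_action \<mu> \<nu> = (INF H \<in> {H. admissible \<mu> \<nu> H}. flow_action H)"

text \<open>
  By compactness of \<open>D \<times> D\<close> the bounded continuous test functions are all the continuous ones.
\<close>

definition narrowly_converges ::
  "(nat \<Rightarrow> (real \<times> real) measure) \<Rightarrow> (real \<times> real) measure \<Rightarrow> bool" where
  "narrowly_converges \<nu> \<nu>\<^sub>0 \<longleftrightarrow>
     (\<forall>\<alpha> :: real \<times> real \<Rightarrow> real. continuous_on (D \<times> D) \<alpha> \<longrightarrow>
        (\<lambda>n. integral\<^sup>L (\<nu> n) \<alpha>) \<longlonglongrightarrow> integral\<^sup>L \<nu>\<^sub>0 \<alpha>)"

definition narrowly_continuous :: "((real \<times> real) measure \<Rightarrow> ennreal) \<Rightarrow> bool" where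
  "narrowly_continuous F \<longleftrightarrow>
     (\<forall>\<nu> \<nu>\<^sub>0. (\<forall>n. bistochastic (\<nu> n)) \<longrightarrow> bistochastic \<nu>\<^sub>0 \<longrightarrow>
        narrowly_converges \<nu> \<nu>\<^sub>0 \<longrightarrow> (\<lambda>n. F (\<nu> n)) \<longlonglongrightarrow> F \<nu>\<^sub>0)"

text \<open>
  The measure is unique whenever it exists, and for a positive linear functional it exists by the
  Riesz representation theorem. At \<open>n = 0\<close> the functional below is zero, which is irrelevant for limits.
\<close>

definition measure_with_integrals ::
  "((real \<times> real \<Rightarrow> real) \<Rightarrow> real) \<Rightarrow> (real \<times> real) measure" where
  "measure_with_integrals L =
     (THE \<mu>. sets \<mu> = sets borel_square \<and>
        (\<forall>\<alpha>. continuous_on (D \<times> D) \<alpha> \<longrightarrow> integrable \<mu> \<alpha> \<and> integral\<^sup>L \<mu> \<alpha> = L \<alpha>))"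

definition mu_inf :: "(real \<times> real) measure" where
  "mu_inf = measure_with_integrals (\<lambda>\<alpha>.
     1/2 * (LBINT x:{0..1}. \<alpha> (x, x/2) + \<alpha> (x, 1/2 + x/2)))"

definition mu :: "nat \<Rightarrow> (real \<times> real) measure" where
  "mu n = measure_with_integrals (\<lambda>\<alpha>.
     \<Sum>i<n. LBINT x:{0..1 / (2 * real n)}.
       \<alpha> (real i / real n + x, real i / (2 * real n) + x) +
       \<alpha> ((2 * real i + 1) / (2 * real n) + x, 1/2 + real i / (2 * real n) + x))"

end

theory Submission
  imports Defs
begin

text \<open>
  Why the theorem is true. Write \<open>doubling\<close> for the doubling map of the unit interval. Under \<open>mu_inf\<close> the second
  coordinate \<open>y\<close> is uniform and the first one is \<open>doubling y\<close>, so a particle marked \<open>a\<close> starts with equal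
  probability at \<open>a/2\<close> or at \<open>1/2 + a/2\<close>. Under \<open>mu n\<close> the second coordinate is uniform as well and the first
  one is a piecewise translation \<open>cell_map n y\<close> with \<open>\<bar>cell_map n y - doubling y\<bar> \<le> 1/(2n)\<close>; narrow
  convergence follows by dominated convergence. But \<open>cell_map n\<close> is injective up to null sets: the
  target is in the lower half of the unit interval exactly when the mark lies in the left half of its
  cell of length \<open>1/n\<close>.

  Hence in every flow from \<open>mu_inf\<close> to \<open>mu n\<close> exactly half of the mass must change the half of the
  interval (\<open>emeasure_swapped\<close>), and each such particle travels a distance at least \<open>1/2 - 1/(4n)\<close>. A path
  with displacement \<open>d\<close> has action at least \<open>d\<^sup>2/2\<close> (\<open>path_action_ge\<close>), so the action of the flow is at least
  \<open>1/4 * (1/2 - 1/(4n))\<^sup>2\<close> (\<open>flow_action_lower_bound\<close>), which tends to \<open>1/16\<close>. On the other hand the flow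
  of constant paths carries \<open>mu_inf\<close> to itself with action \<open>0\<close> (\<open>optimal_action_mu_inf_self\<close>).

  The bound \<open>path_action_ge\<close> rests on the fundamental theorem of calculus for absolutely continuous
  functions, because the action only sees the pointwise derivative. An absolutely continuous \<open>F\<close> is the
  difference of its positive variation and the function \<open>pos_variation F - F\<close>; both are nondecreasing
  and absolutely continuous. The Stieltjes measure of such a function is absolutely continuous with
  respect to Lebesgue measure, so the Radon-Nikodym theorem gives a density
  (\<open>mono_abs_cont_eq_integral\<close>), and \<open>F\<close> is the indefinite integral of an integrable \<open>g\<close>. The Lebesgue
  differentiation theorem, derived from the Vitali covering theorem (\<open>AE_interval_average_le\<close>), shows that
  \<open>F\<close> has derivative \<open>g\<close> almost everywhere.
\<close>

section \<open>Finite families of intervals and absolute continuity\<close>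

text \<open>
  A finite set of nonoverlapping intervals, given by their end points. Degenerate intervals are
  allowed, and they may coincide with end points of, or lie inside, other members of the family.
\<close>

definition interval_family :: "(real \<times> real) set \<Rightarrow> bool" where
  "interval_family I \<longleftrightarrow> finite I \<and> (\<forall>(u, v)\<in>I. u \<le> v) \<and>
     disjoint_family_on (\<lambda>(u, v). {u<..<v}) I"

text \<open>
  The sum of the lengths of the intervals.
\<close>

definition total_length :: "(real \<times> real) set \<Rightarrow> real" where
  "total_length I = (\<Sum>(u, v)\<in>I. v - u)"

text \<open>
  The sum of the signed increments of \<open>F\<close> over the intervals.
\<close>

definition increment :: "(real \<Rightarrow> real) \<Rightarrow> (real \<times> real) set \<Rightarrow> real" where
  "increment F I = (\<Sum>(u, v)\<in>I. F v - F u)"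

text \<open>
  Absolute continuity on the whole real line, with one modulus \<open>\<delta>\<close> for all families of intervals.
\<close>

definition abs_cont :: "(real \<Rightarrow> real) \<Rightarrow> bool" where
  "abs_cont F \<longleftrightarrow> (\<forall>\<epsilon>>0. \<exists>\<delta>>0. \<forall>I. interval_family I \<longrightarrow> total_length I < \<delta> \<longrightarrow>
     (\<Sum>(u, v)\<in>I. \<bar>F v - F u\<bar>) < \<epsilon>)"

lemma interval_familyD:
  assumes "interval_family I"
  shows "finite I" "p \<in> I \<Longrightarrow> fst p \<le> snd p"
    "p \<in> I \<Longrightarrow> q \<in> I \<Longrightarrow> p \<noteq> q \<Longrightarrow>
       fst p = snd p \<or> fst q = snd q \<or> snd p \<le> fst q \<or> snd q \<le> fst p"
proof -
  show "finite I" "p \<in> I \<Longrightarrow> fst p \<le> snd p"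
    using assms by (auto simp: interval_family_def)
  assume pq: "p \<in> I" "q \<in> I" "p \<noteq> q"
  then have *: "{fst p<..<snd p} \<inter> {fst q<..<snd q} = {}"
    using assms unfolding interval_family_def disjoint_family_on_def by (auto simp: split_beta)
  show "fst p = snd p \<or> fst q = snd q \<or> snd p \<le> fst q \<or> snd q \<le> fst p"
  proof (rule ccontr)
    assume c: "\<not> ?thesis"
    have "fst p < snd p" "fst q < snd q"
      using c pq assms by (auto simp: interval_family_def split_beta order_less_le)
    then have "max (fst p) (fst q) < min (snd p) (snd q)"
      using c by auto
    then obtain z where "max (fst p) (fst q) < z" "z < min (snd p) (snd q)"
      using dense by blast
    then have "z \<in> {fst p<..<snd p} \<inter> {fst q<..<snd q}" by auto
    with * show False by auto
  qed
qed

lemma interval_familyI: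
  assumes "finite I" "\<And>p. p \<in> I \<Longrightarrow> fst p \<le> snd p"
    "\<And>p q. p \<in> I \<Longrightarrow> q \<in> I \<Longrightarrow> p \<noteq> q \<Longrightarrow>
       fst p = snd p \<or> fst q = snd q \<or> snd p \<le> fst q \<or> snd q \<le> fst p"
  shows "interval_family I"
  unfolding interval_family_def disjoint_family_on_def
proof (intro conjI ballI impI)
  show "finite I" by fact
  show "case p of (u, v) \<Rightarrow> u \<le> v" if "p \<in> I" for p
    using assms(2)[OF that] by (simp add: split_beta)
  show "(case p of (u, v) \<Rightarrow> {u<..<v}) \<inter> (case q of (u, v) \<Rightarrow> {u<..<v}) = {}"
    if "p \<in> I" "q \<in> I" "p \<noteq> q" for p q
    using assms(3)[OF that] assms(2)[of p] assms(2)[of q] that by (auto simp: split_beta)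
qed

lemma interval_family_subset: "interval_family I \<Longrightarrow> J \<subseteq> I \<Longrightarrow> interval_family J"
  by (auto intro!: interval_familyI dest: interval_familyD intro: finite_subset)

text \<open>
  Images under monotone maps of the line keep intervals nonoverlapping. Applied to \<open>min c\<close>, \<open>max c\<close>
  and to the projection onto \<open>[0,1]\<close>, this cuts a family at \<open>c\<close> or restricts it to \<open>[0,1]\<close>.
\<close>

lemma interval_family_map:
  fixes \<phi> :: "real \<Rightarrow> real"
  assumes I: "interval_family I" and \<phi>: "mono \<phi>"
  shows "interval_family (map_prod \<phi> \<phi> ` I)"
proof (rule interval_familyI)
  show "finite (map_prod \<phi> \<phi> ` I)"
    using interval_familyD(1)[OF I] by simp
  show "fst p \<le> snd p" if "p \<in> map_prod \<phi> \<phi> ` I" for p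
    using that interval_familyD(2)[OF I] monoD[OF \<phi>] by force
  fix p q assume "p \<in> map_prod \<phi> \<phi> ` I" "q \<in> map_prod \<phi> \<phi> ` I" "p \<noteq> q"
  then obtain p' q' where *: "p' \<in> I" "q' \<in> I" "p = map_prod \<phi> \<phi> p'" "q = map_prod \<phi> \<phi> q'" "p' \<noteq> q'"
    by (metis imageE)
  then show "fst p = snd p \<or> fst q = snd q \<or> snd p \<le> fst q \<or> snd q \<le> fst p"
    using interval_familyD(3)[OF I, of p' q'] monoD[OF \<phi>]
    by (metis fst_map_prod snd_map_prod)
qed

text \<open>
  The image map need not be injective on the family, but intervals with the same image have a
  degenerate image, on which \<open>g\<close> vanishes.
\<close>

lemma sum_interval_family_map:
  fixes \<phi> :: "real \<Rightarrow> real" and g :: "real \<times> real \<Rightarrow> real"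
  assumes I: "interval_family I" and \<phi>: "mono \<phi>" and g: "\<And>x. g (x, x) = 0"
  shows "(\<Sum>p\<in>map_prod \<phi> \<phi> ` I. g p) = (\<Sum>(u, v)\<in>I. g (\<phi> u, \<phi> v))"
proof -
  have "(\<Sum>p\<in>map_prod \<phi> \<phi> ` I. g p) = sum (g \<circ> map_prod \<phi> \<phi>) I"
  proof (rule sum.reindex_nontrivial)
    show "finite I" using interval_familyD(1)[OF I] .
    fix p q assume pq: "p \<in> I" "q \<in> I" "p \<noteq> q" "map_prod \<phi> \<phi> p = map_prod \<phi> \<phi> q"
    have le: "fst p \<le> snd p" "fst q \<le> snd q"
      using interval_familyD(2)[OF I] pq by auto
    have eq: "\<phi> (fst p) = \<phi> (fst q)" "\<phi> (snd p) = \<phi> (snd q)"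
      using pq(4) by (auto simp: map_prod_def split_beta)
    have "\<phi> (fst p) = \<phi> (snd p)"
      using interval_familyD(3)[OF I pq(1-3)] le eq monoD[OF \<phi>]
      by (metis order.antisym)
    then show "g (map_prod \<phi> \<phi> p) = 0"
      using g by (simp add: map_prod_def split_beta)
  qed
  also have "\<dots> = (\<Sum>(u, v)\<in>I. g (\<phi> u, \<phi> v))"
    by (rule sum.cong) auto
  finally show ?thesis .
qed

lemma total_length_eq_emeasure:
  assumes "interval_family I"
  shows "ennreal (total_length I) = emeasure lborel (\<Union>(u, v)\<in>I. {u<..<v})"
proof -
  have "ennreal (total_length I) = (\<Sum>(u, v)\<in>I. ennreal (v - u))"
    unfolding total_length_def split_beta
    using interval_familyD(2)[OF assms] by (subst sum_ennreal) auto
  also have "\<dots> = (\<Sum>p\<in>I. emeasure lborel ((\<lambda>(u, v). {u<..<v}) p))"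
    using interval_familyD(2)[OF assms] by (intro sum.cong) auto
  also have "\<dots> = emeasure lborel (\<Union>p\<in>I. (\<lambda>(u, v). {u<..<v}) p)"
    using assms by (intro sum_emeasure) (auto simp: interval_family_def)
  finally show ?thesis .
qed

lemma total_length_le:
  assumes I: "interval_family I" and ab: "a \<le> b" and sub: "\<And>u v. (u, v) \<in> I \<Longrightarrow> a \<le> u \<and> v \<le> b"
  shows "total_length I \<le> b - a"
proof -
  have "ennreal (total_length I) \<le> emeasure lborel {a..b}"
    unfolding total_length_eq_emeasure[OF I]
  proof (rule emeasure_mono)
    show "(\<Union>(u, v)\<in>I. {u<..<v}) \<subseteq> {a..b}"
      using sub by fastforce
  qed simp
  also have "\<dots> = ennreal (b - a)" using ab by simp
  finally show ?thesis using ab by (simp add: ennreal_le_iff)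
qed

lemma mono_min_right: "mono (\<lambda>x. min x (c::real))" and mono_max_right: "mono (\<lambda>x. max x (c::real))"
  by (auto simp: mono_def)

lemma increment_split:
  assumes I: "interval_family I"
  shows "increment F I = increment F (map_prod (\<lambda>x. min x c) (\<lambda>x. min x c) ` I)
    + increment F (map_prod (\<lambda>x. max x c) (\<lambda>x. max x c) ` I)"
proof -
  have 1: "increment F (map_prod \<phi> \<phi> ` I) = (\<Sum>(u, v)\<in>I. F (\<phi> v) - F (\<phi> u))" if "mono \<phi>" for \<phi>
    using sum_interval_family_map[OF I that, of "\<lambda>(u, v). F v - F u"] by (simp add: increment_def)
  show ?thesis
    unfolding 1[OF mono_min_right] 1[OF mono_max_right] sum.distrib[symmetric]
    unfolding increment_def by (rule sum.cong) (auto simp: min_def max_def)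
qed

lemma increment_abs_le: "increment F I \<le> (\<Sum>(u, v)\<in>I. \<bar>F v - F u\<bar>)"
  unfolding increment_def by (intro sum_mono) auto

lemma abs_contD:
  assumes "abs_cont F" "\<epsilon> > 0"
  obtains \<delta> where "\<delta> > 0" "\<And>I. interval_family I \<Longrightarrow> total_length I < \<delta> \<Longrightarrow>
     (\<Sum>(u, v)\<in>I. \<bar>F v - F u\<bar>) < \<epsilon>"
  using assms unfolding abs_cont_def by meson

lemma abs_cont_diff:
  assumes F: "abs_cont F" and G: "abs_cont G"
  shows "abs_cont (\<lambda>x. F x - G x)"
  unfolding abs_cont_def
proof (intro allI impI)
  fix \<epsilon> :: real assume "\<epsilon> > 0"
  then have "\<epsilon> / 2 > 0" by simp
  obtain \<delta>1 where \<delta>1: "\<delta>1 > 0" "\<And>I. interval_family I \<Longrightarrow> total_length I < \<delta>1 \<Longrightarrow>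
     (\<Sum>(u, v)\<in>I. \<bar>F v - F u\<bar>) < \<epsilon> / 2"
    using abs_contD[OF F \<open>\<epsilon> / 2 > 0\<close>] by blast
  obtain \<delta>2 where \<delta>2: "\<delta>2 > 0" "\<And>I. interval_family I \<Longrightarrow> total_length I < \<delta>2 \<Longrightarrow>
     (\<Sum>(u, v)\<in>I. \<bar>G v - G u\<bar>) < \<epsilon> / 2"
    using abs_contD[OF G \<open>\<epsilon> / 2 > 0\<close>] by blast
  show "\<exists>\<delta>>0. \<forall>I. interval_family I \<longrightarrow> total_length I < \<delta> \<longrightarrow>
     (\<Sum>(u, v)\<in>I. \<bar>F v - G v - (F u - G u)\<bar>) < \<epsilon>"
  proof (intro exI[of _ "min \<delta>1 \<delta>2"] conjI allI impI)
    fix I assume I: "interval_family I" "total_length I < min \<delta>1 \<delta>2"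
    have "(\<Sum>(u, v)\<in>I. \<bar>F v - G v - (F u - G u)\<bar>)
        \<le> (\<Sum>(u, v)\<in>I. \<bar>F v - F u\<bar>) + (\<Sum>(u, v)\<in>I. \<bar>G v - G u\<bar>)"
      unfolding sum.distrib[symmetric] by (intro sum_mono) auto
    also have "\<dots> < \<epsilon> / 2 + \<epsilon> / 2"
      using \<delta>1(2)[OF I(1)] \<delta>2(2)[OF I(1)] I(2) by (intro add_strict_mono) auto
    finally show "(\<Sum>(u, v)\<in>I. \<bar>F v - G v - (F u - G u)\<bar>) < \<epsilon>" by simp
  qed (use \<delta>1 \<delta>2 in auto)
qed

lemma abs_cont_continuous:
  assumes "abs_cont F"
  shows "continuous_on UNIV F"
  unfolding continuous_on_iff
proof (intro ballI allI impI)
  fix x \<epsilon> :: real assume "\<epsilon> > 0"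
  then obtain \<delta> where \<delta>: "\<delta> > 0" "\<And>I. interval_family I \<Longrightarrow> total_length I < \<delta> \<Longrightarrow>
     (\<Sum>(u, v)\<in>I. \<bar>F v - F u\<bar>) < \<epsilon>"
    using abs_contD[OF assms] by blast
  show "\<exists>d>0. \<forall>x'\<in>UNIV. dist x' x < d \<longrightarrow> dist (F x') (F x) < \<epsilon>"
  proof (intro exI[of _ \<delta>] conjI ballI impI)
    fix y assume "dist y x < \<delta>"
    then have d: "\<bar>y - x\<bar> < \<delta>" by (simp add: dist_real_def)
    have "interval_family {(min x y, max x y)}"
      by (rule interval_familyI) auto
    moreover have "total_length {(min x y, max x y)} < \<delta>"
      using d by (auto simp: total_length_def min_def max_def)
    ultimately have "\<bar>F (max x y) - F (min x y)\<bar> < \<epsilon>"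
      using \<delta>(2) by fastforce
    then show "dist (F y) (F x) < \<epsilon>"
      by (auto simp: dist_real_def min_def max_def abs_minus_commute split: if_splits)
  qed (use \<delta> in auto)
qed

text \<open>
  The unit interval is covered by \<open>N\<close> intervals of length \<open>1/N\<close> below the modulus \<open>\<delta>\<close> that belongs to \<open>\<epsilon> = 1\<close>;
  each of them contributes at most \<open>1\<close> to the increment of a family.
\<close>

lemma abs_cont_bounded_variation:
  assumes F: "abs_cont F" and 0: "\<And>x. x \<le> 0 \<Longrightarrow> F x = F 0" and 1: "\<And>x. 1 \<le> x \<Longrightarrow> F x = F 1"
  shows "\<exists>B. \<forall>I. interval_family I \<longrightarrow> increment F I \<le> B"
proof -
  obtain \<delta> where \<delta>: "\<delta> > 0" "\<And>I. interval_family I \<Longrightarrow> total_length I < \<delta> \<Longrightarrow>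
     (\<Sum>(u, v)\<in>I. \<bar>F v - F u\<bar>) < 1"
    using abs_contD[OF F zero_less_one] by blast
  obtain N :: nat where N: "N > 0" "inverse (real N) < \<delta>"
    using reals_Archimedean[OF \<delta>(1)] by blast
  have *: "increment F I \<le> real k" if "interval_family I" "\<And>p. p \<in> I \<Longrightarrow> snd p \<le> real k / real N" for I k
    using that
  proof (induction k arbitrary: I)
    case 0
    have "F (snd p) - F (fst p) = 0" if "p \<in> I" for p
      using 0(2)[OF that] interval_familyD(2)[OF 0(1) that] assms(2)[of "fst p"] assms(2)[of "snd p"] by simp
    then show ?case by (simp add: increment_def split_beta)
  next
    case (Suc k)
    define c where "c = real k / real N"
    let ?L = "map_prod (\<lambda>x. min x c) (\<lambda>x. min x c) ` I"
    let ?R = "map_prod (\<lambda>x. max x c) (\<lambda>x. max x c) ` I"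
    have "increment F ?L \<le> real k"
      by (rule Suc.IH) (auto simp: c_def intro!: interval_family_map Suc.prems mono_min_right)
    moreover have "increment F ?R \<le> 1"
    proof -
      have R: "interval_family ?R"
        by (intro interval_family_map Suc.prems mono_max_right)
      have "total_length ?R \<le> (c + 1 / real N) - c"
      proof (rule total_length_le[OF R])
        fix u v assume "(u, v) \<in> ?R"
        then obtain p where p: "p \<in> I" "u = max (fst p) c" "v = max (snd p) c" by force
        then show "c \<le> u \<and> v \<le> c + 1 / real N"
          using Suc.prems(2)[OF p(1)] by (auto simp: c_def add_divide_distrib)
      qed simp
      also have "\<dots> < \<delta>" using N by (simp add: divide_inverse)
      finally show ?thesis
        using \<delta>(2)[OF R] increment_abs_le[of F ?R] by simp
    qed
    ultimately show ?case
      using increment_split[OF Suc.prems(1), of F c] by simp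
  qed
  show ?thesis
  proof (intro exI[of _ "real N"] allI impI)
    fix I assume I: "interval_family I"
    let ?L = "map_prod (\<lambda>x. min x 1) (\<lambda>x. min x 1) ` I"
    let ?R = "map_prod (\<lambda>x. max x 1) (\<lambda>x. max x 1) ` I"
    have "increment F ?L \<le> real N"
      by (rule *) (use N in \<open>auto intro!: interval_family_map I mono_min_right\<close>)
    moreover have "increment F ?R = 0"
    proof -
      have "F (snd p) - F (fst p) = 0" if "p \<in> ?R" for p
      proof -
        from that have "1 \<le> fst p" "1 \<le> snd p" by auto
        then show ?thesis using 1[of "fst p"] 1[of "snd p"] by simp
      qed
      then show ?thesis by (simp add: increment_def split_beta)
    qed
    ultimately show "increment F I \<le> real N"
      using increment_split[OF I, of F 1] by simp
  qed
qed

section \<open>Positive variation\<close>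

text \<open>
  The positive variation of \<open>F\<close> on the half line below \<open>x\<close>: the supremum of the signed increments over
  families of intervals. For the functions below, which are constant outside \<open>[0,1]\<close>, the supremum is finite.
\<close>

definition pos_variation :: "(real \<Rightarrow> real) \<Rightarrow> real \<Rightarrow> real" where
  "pos_variation F x = Sup {increment F I | I. interval_family I \<and> (\<forall>p\<in>I. snd p \<le> x)}"

text \<open>
  Absolutely continuous paths on \<open>[0,1]\<close>, extended to the line by constants.
\<close>

locale abs_cont_path =
  fixes F :: "real \<Rightarrow> real"
  assumes ac: "abs_cont F" and left: "\<And>x. x \<le> 0 \<Longrightarrow> F x = F 0" and right: "\<And>x. 1 \<le> x \<Longrightarrow> F x = F 1"
begin

lemma pos_variation_upper:
  assumes "interval_family I" "\<And>p. p \<in> I \<Longrightarrow> snd p \<le> x"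
  shows "increment F I \<le> pos_variation F x"
  unfolding pos_variation_def
proof (rule cSup_upper)
  show "bdd_above {increment F I |I. interval_family I \<and> (\<forall>p\<in>I. snd p \<le> x)}"
    using abs_cont_bounded_variation[OF ac left right] by (fastforce simp: bdd_above_def)
qed (use assms in auto)

lemma pos_variation_ne: "{increment F I |I. interval_family I \<and> (\<forall>p\<in>I. snd p \<le> x)} \<noteq> {}"
proof -
  have "interval_family {}" by (rule interval_familyI) auto
  then show ?thesis by blast
qed

lemma pos_variation_least:
  assumes "\<And>I. interval_family I \<Longrightarrow> (\<And>p. p \<in> I \<Longrightarrow> snd p \<le> x) \<Longrightarrow> increment F I \<le> B"
  shows "pos_variation F x \<le> B"
  unfolding pos_variation_def by (rule cSup_least[OF pos_variation_ne]) (use assms in auto)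

lemma pos_variation_mono: "x \<le> y \<Longrightarrow> pos_variation F x \<le> pos_variation F y"
  by (rule pos_variation_least) (force intro: pos_variation_upper)

lemma pos_variation_increment:
  assumes "x \<le> y"
  shows "F y - F x \<le> pos_variation F y - pos_variation F x"
proof (cases "x = y")
  case False
  with assms have xy: "x < y" by simp
  have "pos_variation F x \<le> pos_variation F y - (F y - F x)"
  proof (rule pos_variation_least)
    fix I assume I: "interval_family I" "\<And>p. p \<in> I \<Longrightarrow> snd p \<le> x"
    have "interval_family (insert (x, y) I)"
    proof (rule interval_familyI)
      show "finite (insert (x, y) I)" using interval_familyD(1)[OF I(1)] by simp
      show "fst p \<le> snd p" if "p \<in> insert (x, y) I" for p
        using that xy interval_familyD(2)[OF I(1)] by auto
      show "fst p = snd p \<or> fst q = snd q \<or> snd p \<le> fst q \<or> snd q \<le> fst p"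
        if "p \<in> insert (x, y) I" "q \<in> insert (x, y) I" "p \<noteq> q" for p q
        using that I(2)[of p] I(2)[of q] interval_familyD(3)[OF I(1), of p q] by auto
    qed
    then have "increment F (insert (x, y) I) \<le> pos_variation F y"
    proof (rule pos_variation_upper)
      show "snd p \<le> y" if "p \<in> insert (x, y) I" for p
        using that I(2)[of p] xy by auto
    qed
    moreover have "(x, y) \<notin> I" using I(2)[of "(x, y)"] xy by auto
    ultimately show "increment F I \<le> pos_variation F y - (F y - F x)"
      using interval_familyD(1)[OF I(1)] by (simp add: increment_def)
  qed
  then show ?thesis by simp
qed simp

text \<open>
  The positive variation gained between \<open>u\<close> and \<open>v\<close> is approximated by families inside \<open>[u,v]\<close>: a nearly
  optimal family below \<open>v\<close> is cut at \<open>u\<close>, and its lower part contributes at most \<open>pos_variation F u\<close>.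
\<close>

lemma pos_variation_approx:
  assumes "u \<le> v" "\<eta> > 0"
  shows "\<exists>I. interval_family I \<and> (\<forall>p\<in>I. u \<le> fst p \<and> fst p < snd p \<and> snd p \<le> v) \<and>
    pos_variation F v - pos_variation F u \<le> increment F I + \<eta>"
proof -
  have "\<exists>K. interval_family K \<and> (\<forall>p\<in>K. snd p \<le> v) \<and> pos_variation F v - \<eta> < increment F K"
  proof (rule ccontr)
    assume none: "\<not> ?thesis"
    have "pos_variation F v \<le> pos_variation F v - \<eta>"
    proof (rule pos_variation_least)
      fix I assume "interval_family I" "\<And>p. p \<in> I \<Longrightarrow> snd p \<le> v"
      with none show "increment F I \<le> pos_variation F v - \<eta>" by (meson not_le)
    qed
    with assms show False by simp
  qed
  then obtain K where K: "interval_family K" "\<And>p. p \<in> K \<Longrightarrow> snd p \<le> v" "pos_variation F v - \<eta> < increment F K"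
    by blast
  let ?L = "map_prod (\<lambda>x. min x u) (\<lambda>x. min x u) ` K"
  let ?R = "map_prod (\<lambda>x. max x u) (\<lambda>x. max x u) ` K"
  define I where "I = {p \<in> ?R. fst p < snd p}"
  have R: "interval_family ?R"
    by (intro interval_family_map K mono_max_right)
  have "increment F ?L \<le> pos_variation F u"
    by (rule pos_variation_upper) (auto intro!: interval_family_map K mono_min_right)
  moreover have "increment F ?R = increment F I"
    unfolding increment_def
  proof (rule sum.mono_neutral_right)
    show "finite ?R" using interval_familyD(1)[OF R] .
    show "\<forall>p\<in>?R - I. (case p of (u, v) \<Rightarrow> F v - F u) = 0"
    proof
      fix p assume p: "p \<in> ?R - I"
      then have "fst p \<le> snd p" using interval_familyD(2)[OF R] by blast
      with p have "fst p = snd p" by (auto simp: I_def)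
      then show "(case p of (u, v) \<Rightarrow> F v - F u) = 0" by (simp add: split_beta)
    qed
  qed (auto simp: I_def)
  ultimately have "pos_variation F v - pos_variation F u \<le> increment F I + \<eta>"
    using increment_split[OF K(1), of F u] K(3) by simp
  moreover have "interval_family I"
    using R by (rule interval_family_subset) (auto simp: I_def)
  moreover have "u \<le> fst p \<and> fst p < snd p \<and> snd p \<le> v" if "p \<in> I" for p
    using that K(2) assms by (force simp: I_def)
  ultimately show ?thesis by blast
qed

text \<open>
  For a family \<open>J\<close> of small total length, nearly optimal families inside the members of \<open>J\<close> combine to a
  single family of no larger total length, to which absolute continuity of \<open>F\<close> applies.
\<close>

lemma abs_cont_pos_variation: "abs_cont (pos_variation F)"
  unfolding abs_cont_def
proof (intro allI impI)
  fix \<epsilon> :: real assume \<epsilon>: "\<epsilon> > 0"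
  then have "\<epsilon> / 2 > 0" by simp
  then obtain \<delta> where \<delta>: "\<delta> > 0" "\<And>I. interval_family I \<Longrightarrow> total_length I < \<delta> \<Longrightarrow>
     (\<Sum>(u, v)\<in>I. \<bar>F v - F u\<bar>) < \<epsilon> / 2"
    using abs_contD[OF ac] by blast
  show "\<exists>\<delta>>0. \<forall>I. interval_family I \<longrightarrow> total_length I < \<delta> \<longrightarrow>
     (\<Sum>(u, v)\<in>I. \<bar>pos_variation F v - pos_variation F u\<bar>) < \<epsilon>"
  proof (intro exI[of _ \<delta>] conjI allI impI \<delta>(1))
    fix J assume J: "interval_family J" "total_length J < \<delta>"
    have finJ: "finite J" using J interval_familyD by blast
    define \<eta> where "\<eta> = \<epsilon> / 2 / (real (card J) + 1)"
    have \<eta>: "\<eta> > 0" using \<epsilon> by (simp add: \<eta>_def)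
    have "\<forall>p\<in>J. \<exists>I. interval_family I \<and> (\<forall>q\<in>I. fst p \<le> fst q \<and> fst q < snd q \<and> snd q \<le> snd p) \<and>
      pos_variation F (snd p) - pos_variation F (fst p) \<le> increment F I + \<eta>"
      using pos_variation_approx[OF _ \<eta>] interval_familyD(2)[OF J(1)] by blast
    then obtain I where I: "\<And>p. p \<in> J \<Longrightarrow> interval_family (I p)"
      "\<And>p q. p \<in> J \<Longrightarrow> q \<in> I p \<Longrightarrow> fst p \<le> fst q \<and> fst q < snd q \<and> snd q \<le> snd p"
      "\<And>p. p \<in> J \<Longrightarrow> pos_variation F (snd p) - pos_variation F (fst p) \<le> increment F (I p) + \<eta>"
      unfolding bchoice_iff by blast
    define U where "U = (\<Union>p\<in>J. I p)"
    have finI: "finite (I p)" if "p \<in> J" for p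
      using I(1)[OF that] interval_familyD by blast
    have sep: "snd r \<le> fst s \<or> snd s \<le> fst r" if "p \<in> J" "q \<in> J" "p \<noteq> q" "r \<in> I p" "s \<in> I q" for p q r s
      using interval_familyD(3)[OF J(1) that(1-3)] I(2)[OF that(1,4)] I(2)[OF that(2,5)] by linarith
    have U: "interval_family U"
    proof (rule interval_familyI)
      show "finite U" using finJ finI by (auto simp: U_def)
      show "fst p \<le> snd p" if "p \<in> U" for p
      proof -
        from that obtain q where "q \<in> J" "p \<in> I q" by (auto simp: U_def)
        then show ?thesis using I(2)[of q p] by simp
      qed
      fix r s assume "r \<in> U" "s \<in> U" "r \<noteq> s"
      then obtain p q where *: "p \<in> J" "q \<in> J" "r \<in> I p" "s \<in> I q" by (auto simp: U_def)
      show "fst r = snd r \<or> fst s = snd s \<or> snd r \<le> fst s \<or> snd s \<le> fst r"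
      proof (cases "p = q")
        case True
        then show ?thesis using interval_familyD(3)[OF I(1), of p r s] * \<open>r \<noteq> s\<close> by blast
      next
        case False
        then show ?thesis using sep * by blast
      qed
    qed
    have sumU: "sum g U = (\<Sum>p\<in>J. sum g (I p))" for g :: "real \<times> real \<Rightarrow> real"
      unfolding U_def
    proof (rule sum.UNION_disjoint[OF finJ])
      show "\<forall>i\<in>J. finite (I i)" using finI by blast
      show "\<forall>i\<in>J. \<forall>j\<in>J. i \<noteq> j \<longrightarrow> I i \<inter> I j = {}"
      proof (intro ballI impI)
        fix p q assume pq: "p \<in> J" "q \<in> J" "p \<noteq> q"
        show "I p \<inter> I q = {}"
        proof (rule ccontr)
          assume "I p \<inter> I q \<noteq> {}"
          then obtain r where "r \<in> I p" "r \<in> I q" by blast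
          with sep[OF pq, of r r] I(2)[OF pq(1), of r] show False by auto
        qed
      qed
    qed
    have "total_length U = (\<Sum>p\<in>J. total_length (I p))"
      unfolding total_length_def by (rule sumU)
    also have "\<dots> \<le> (\<Sum>p\<in>J. snd p - fst p)"
    proof (rule sum_mono)
      fix p assume p: "p \<in> J"
      show "total_length (I p) \<le> snd p - fst p"
      proof (rule total_length_le[OF I(1)[OF p]])
        show "fst p \<le> snd p" by (rule interval_familyD(2)[OF J(1) p])
        show "fst p \<le> u \<and> v \<le> snd p" if "(u, v) \<in> I p" for u v
          using I(2)[OF p that] by simp
      qed
    qed
    also have "\<dots> = total_length J" by (simp add: total_length_def split_beta)
    also have "\<dots> < \<delta>" by fact
    finally have "(\<Sum>(u, v)\<in>U. \<bar>F v - F u\<bar>) < \<epsilon> / 2" by (rule \<delta>(2)[OF U])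
    then have incU: "increment F U < \<epsilon> / 2" using increment_abs_le[of F U] by simp
    have "(\<Sum>(u, v)\<in>J. \<bar>pos_variation F v - pos_variation F u\<bar>)
        = (\<Sum>p\<in>J. pos_variation F (snd p) - pos_variation F (fst p))"
      using pos_variation_mono interval_familyD(2)[OF J(1)]
      by (intro sum.cong) (auto simp: split_beta)
    also have "\<dots> \<le> (\<Sum>p\<in>J. increment F (I p) + \<eta>)"
      by (rule sum_mono) (rule I(3))
    also have "\<dots> = increment F U + real (card J) * \<eta>"
      by (simp add: sum.distrib increment_def sumU)
    also have "real (card J) * \<eta> \<le> \<epsilon> / 2"
      using \<epsilon> by (simp add: \<eta>_def field_simps)
    finally show "(\<Sum>(u, v)\<in>J. \<bar>pos_variation F v - pos_variation F u\<bar>) < \<epsilon>"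
      using incU by simp
  qed
qed

lemma pos_variation_left: "x \<le> 0 \<Longrightarrow> pos_variation F x = pos_variation F 0"
proof (rule antisym)
  assume x: "x \<le> 0"
  then show "pos_variation F x \<le> pos_variation F 0" by (rule pos_variation_mono)
  have a: "pos_variation F 0 \<le> 0"
  proof (rule pos_variation_least)
    fix I assume I: "interval_family I" "\<And>p. p \<in> I \<Longrightarrow> snd p \<le> 0"
    have "F (snd p) - F (fst p) = 0" if "p \<in> I" for p
      using I(2)[OF that] interval_familyD(2)[OF I(1) that] left[of "fst p"] left[of "snd p"] by simp
    then show "increment F I \<le> 0" by (simp add: increment_def split_beta)
  qed
  have "increment F {} \<le> pos_variation F x"
    by (rule pos_variation_upper) (auto intro: interval_familyI)
  with a show "pos_variation F 0 \<le> pos_variation F x" by (simp add: increment_def)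
qed

lemma pos_variation_right: "1 \<le> x \<Longrightarrow> pos_variation F x = pos_variation F 1"
proof (rule antisym)
  assume x: "1 \<le> x"
  then show "pos_variation F 1 \<le> pos_variation F x" by (rule pos_variation_mono)
  show "pos_variation F x \<le> pos_variation F 1"
  proof (rule pos_variation_least)
    fix I assume I: "interval_family I" "\<And>p. p \<in> I \<Longrightarrow> snd p \<le> x"
    let ?L = "map_prod (\<lambda>x. min x 1) (\<lambda>x. min x 1) ` I"
    let ?R = "map_prod (\<lambda>x. max x 1) (\<lambda>x. max x 1) ` I"
    have "increment F ?L \<le> pos_variation F 1"
      by (rule pos_variation_upper) (auto intro!: interval_family_map I mono_min_right)
    moreover have "increment F ?R = 0"
    proof -
      have "F (snd p) - F (fst p) = 0" if "p \<in> ?R" for p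
      proof -
        from that have "1 \<le> fst p" "1 \<le> snd p" by auto
        then show ?thesis using right[of "fst p"] right[of "snd p"] by simp
      qed
      then show ?thesis by (simp add: increment_def split_beta)
    qed
    ultimately show "increment F I \<le> pos_variation F 1"
      using increment_split[OF I(1), of F 1] by simp
  qed
qed

end

section \<open>The density of a nondecreasing absolutely continuous function\<close>

text \<open>
  The Stieltjes measure of a nondecreasing absolutely continuous function vanishes on Lebesgue null
  sets. A null set lies in an open set of small Lebesgue measure and is covered by countably many
  nonoverlapping closed intervals inside that open set; absolute continuity bounds the increments
  over finitely many of them.
\<close>

lemma interval_measure_null_of_abs_cont:
  assumes F: "abs_cont F" and mono: "\<And>x y. x \<le> y \<Longrightarrow> F x \<le> F y"
    and S: "S \<in> null_sets lborel" "S \<subseteq> {a..b}" and ab: "a < b" and \<epsilon>: "\<epsilon> > 0"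
  shows "emeasure (interval_measure F) S \<le> ennreal \<epsilon>"
proof -
  note contF = abs_cont_continuous[OF F]
  have Ssets[measurable]: "S \<in> sets borel" using S by auto
  obtain \<delta> where \<delta>: "\<delta> > 0" "\<And>I. interval_family I \<Longrightarrow> total_length I < \<delta> \<Longrightarrow>
     (\<Sum>(u, v)\<in>I. \<bar>F v - F u\<bar>) < \<epsilon>"
    using abs_contD[OF F \<epsilon>] by blast
  obtain U where U: "open U" "S \<subseteq> U" "emeasure lborel (U - S) < ennreal \<delta>"
    using outer_regular_lborel[OF Ssets \<delta>(1)] by blast
  have lU: "emeasure lborel U < ennreal \<delta>"
    using U S emeasure_Diff_null_set[of S lborel U] by auto
  define \<gamma> where "\<gamma> x = (if x \<in> U then U else UNIV)" for x
  have "gauge \<gamma>" using U by (auto simp: gauge_def \<gamma>_def)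
  moreover have "S \<subseteq> cbox a b" "box a b \<noteq> {}" using S ab by auto
  ultimately obtain \<D> where \<D>: "countable \<D>" "\<And>K. K \<in> \<D> \<Longrightarrow> interior K \<noteq> {} \<and> (\<exists>c d. K = cbox c d)"
    "pairwise (\<lambda>A B. interior A \<inter> interior B = {}) \<D>"
    "\<And>K. K \<in> \<D> \<Longrightarrow> \<exists>x \<in> S \<inter> K. K \<subseteq> \<gamma> x" "S \<subseteq> \<Union>\<D>"
    using covering_lemma[of S a b \<gamma>] by metis
  have KU: "K \<subseteq> U" if "K \<in> \<D>" for K
    using \<D>(4)[OF that] U(2) by (auto simp: \<gamma>_def split: if_splits)
  have KI: "Inf K < Sup K \<and> K = {Inf K..Sup K}" if KD: "K \<in> \<D>" for K
  proof -
    obtain c d where K: "K = {c..d}" "interior K \<noteq> {}" using \<D>(2)[OF KD] by auto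
    then have "c < d" by (auto simp: not_le)
    then show ?thesis by (simp add: K)
  qed
  have KI1: "Inf K < Sup K" if "K \<in> \<D>" for K
    using KI[OF that] by (rule conjunct1)
  have KI2: "interior K = {Inf K<..<Sup K}" if "K \<in> \<D>" for K
  proof -
    have "interior K = interior {Inf K..Sup K}" using KI[OF that] by metis
    then show ?thesis by simp
  qed
  have Kb: "K \<in> sets borel" if "K \<in> \<D>" for K
    using KI[OF that] by (metis atLeastAtMost_borel)
  have fin: "emeasure (interval_measure F) (\<Union>T) \<le> ennreal \<epsilon>" if T: "finite T" "T \<subseteq> \<D>" for T
  proof -
    define e where "e K = (Inf K, Sup K)" for K :: "real set"
    have inj: "inj_on e T"
    proof (rule inj_onI)
      fix K L assume "K \<in> T" "L \<in> T" "e K = e L"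
      then have D: "K \<in> \<D>" "L \<in> \<D>" and eq: "Inf K = Inf L" "Sup K = Sup L"
        using T by (auto simp: e_def)
      have "K = {Inf K..Sup K}" by (rule KI[OF D(1), THEN conjunct2])
      also have "\<dots> = {Inf L..Sup L}" unfolding eq ..
      also have "\<dots> = L" by (rule KI[OF D(2), THEN conjunct2, symmetric])
      finally show "K = L" .
    qed
    have dis: "{Inf K<..<Sup K} \<inter> {Inf L<..<Sup L} = {}" if KL: "K \<in> T" "L \<in> T" "K \<noteq> L" for K L
    proof -
      have "interior K \<inter> interior L = {}"
        using \<D>(3) KL T by (auto simp: pairwise_def)
      moreover have "interior K = {Inf K<..<Sup K}" "interior L = {Inf L<..<Sup L}"
        using KI2 KL T by auto
      ultimately show ?thesis by simp
    qed
    have I: "interval_family (e ` T)"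
      unfolding interval_family_def disjoint_family_on_def
      using KI1 T dis by (auto simp: e_def less_imp_le subset_iff)
    have "ennreal (total_length (e ` T)) \<le> emeasure lborel U"
      unfolding total_length_eq_emeasure[OF I]
    proof (rule emeasure_mono)
      have "{Inf K<..<Sup K} \<subseteq> U" if "K \<in> T" for K
        using KI2[of K] KU[of K] interior_subset[of K] that T by auto
      then show "(\<Union>(u, v)\<in>e ` T. {u<..<v}) \<subseteq> U" by (auto simp: e_def)
    qed (use U in auto)
    also note lU
    finally have "total_length (e ` T) < \<delta>"
      by (metis ennreal_leI not_le)
    then have *: "(\<Sum>(u, v)\<in>e ` T. \<bar>F v - F u\<bar>) < \<epsilon>" by (rule \<delta>(2)[OF I])
    have "emeasure (interval_measure F) (\<Union>T) \<le> (\<Sum>K\<in>T. emeasure (interval_measure F) K)"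
      using emeasure_subadditive_finite[of T "\<lambda>K. K" "interval_measure F"] T Kb by auto
    also have "\<dots> = (\<Sum>K\<in>T. ennreal \<bar>F (Sup K) - F (Inf K)\<bar>)"
    proof (rule sum.cong)
      fix K assume "K \<in> T"
      then have "K \<in> \<D>" using T by blast
      note K = KI[OF this, THEN conjunct1] KI[OF this, THEN conjunct2]
      have "emeasure (interval_measure F) {Inf K..Sup K} = ennreal (F (Sup K) - F (Inf K))"
        using K(1) by (intro emeasure_interval_measure_Icc mono contF) auto
      then have "emeasure (interval_measure F) K = ennreal (F (Sup K) - F (Inf K))"
        by (rule trans[OF arg_cong[OF K(2)]])
      then show "emeasure (interval_measure F) K = ennreal \<bar>F (Sup K) - F (Inf K)\<bar>"
        using K(1) mono[of "Inf K" "Sup K"] by simp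
    qed simp
    also have "\<dots> = ennreal (\<Sum>(u, v)\<in>e ` T. \<bar>F v - F u\<bar>)"
      by (subst sum.reindex[OF inj]) (simp add: e_def sum_ennreal)
    also have "\<dots> \<le> ennreal \<epsilon>" using * by (intro ennreal_leI) simp
    finally show ?thesis .
  qed
  show ?thesis
  proof (cases "\<D> = {}")
    case True
    then show ?thesis using \<D>(5) by simp
  next
    case False
    define A where "A n = \<Union>(from_nat_into \<D> ` {..<n})" for n
    have sub: "from_nat_into \<D> ` {..<n} \<subseteq> \<D>" for n
      using from_nat_into[OF False] by blast
    have "incseq A" by (force simp: A_def incseq_def)
    moreover have "range A \<subseteq> sets (interval_measure F)"
      using sub Kb by (auto simp: A_def intro!: sets.finite_UN)
    ultimately have "(SUP n. emeasure (interval_measure F) (A n)) = emeasure (interval_measure F) (\<Union>n. A n)"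
      by (intro SUP_emeasure_incseq) auto
    moreover have "(SUP n. emeasure (interval_measure F) (A n)) \<le> ennreal \<epsilon>"
      unfolding A_def by (intro SUP_least fin sub) auto
    moreover have "emeasure (interval_measure F) S \<le> emeasure (interval_measure F) (\<Union>n. A n)"
    proof (rule emeasure_mono)
      show "(\<Union>n. A n) \<in> sets (interval_measure F)"
        using \<open>range A \<subseteq> _\<close> by (intro sets.countable_UN) auto
      show "S \<subseteq> (\<Union>n. A n)"
      proof
        fix x assume "x \<in> S"
        then obtain K where K: "K \<in> \<D>" "x \<in> K" using \<D>(5) by blast
        then obtain n where "from_nat_into \<D> n = K"
          using \<D>(1) from_nat_into_surj by metis
        then have "x \<in> A (Suc n)" using K by (auto simp: A_def)
        then show "x \<in> (\<Union>n. A n)" by blast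
      qed
    qed
    ultimately show ?thesis by simp
  qed
qed

lemma mono_abs_cont_eq_integral:
  assumes F: "abs_cont F" and mono: "\<And>x y. x \<le> y \<Longrightarrow> F x \<le> F y"
    and left: "\<And>x. x \<le> 0 \<Longrightarrow> F x = F 0" and right: "\<And>x. 1 \<le> x \<Longrightarrow> F x = F 1"
  shows "\<exists>g. integrable lborel g \<and> (\<forall>u v. u \<le> v \<longrightarrow> F v - F u = (LBINT t:{u..v}. g t))"
proof -
  note contF = abs_cont_continuous[OF F]
  have rc: "continuous (at_right a) F" for a
    using contF by (meson UNIV_I continuous_on_eq_continuous_within continuous_within_subset subset_UNIV)
  define \<nu> where "\<nu> = interval_measure F"
  have [measurable_cong, simp]: "sets \<nu> = sets borel" and [simp]: "space \<nu> = UNIV"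
    by (simp_all add: \<nu>_def)
  have Icc: "emeasure \<nu> {u..v} = ennreal (F v - F u)" if "u \<le> v" for u v
    unfolding \<nu>_def by (rule emeasure_interval_measure_Icc[OF that mono contF])
  have fin: "emeasure \<nu> UNIV \<noteq> \<infinity>"
  proof -
    have "(SUP n. emeasure \<nu> {- real n..real n}) = emeasure \<nu> (\<Union>n. {- real n..real n})"
      by (rule SUP_emeasure_incseq) (auto simp: incseq_def)
    moreover have "(\<Union>n. {- real n..real n}) = UNIV"
    proof -
      have "\<exists>n. x \<in> {- real n..real n}" for x
      proof -
        obtain n where "\<bar>x\<bar> < real n" using reals_Archimedean2 by blast
        then show ?thesis by (intro exI[of _ n]) auto
      qed
      then show ?thesis by blast
    qed
    moreover have "(SUP n. emeasure \<nu> {- real n..real n}) \<le> ennreal (F 1 - F 0)"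
    proof (rule SUP_least)
      fix n
      have "F (real n) \<le> F 1" using mono[of "real n" 1] right[of "real n"] by (cases "real n \<le> 1") auto
      moreover have "F (- real n) = F 0" by (rule left) simp
      ultimately show "emeasure \<nu> {- real n..real n} \<le> ennreal (F 1 - F 0)"
        by (subst Icc) (auto intro!: ennreal_leI)
    qed
    ultimately show ?thesis by (auto simp: top_unique)
  qed
  have ac: "absolutely_continuous lborel \<nu>"
    unfolding absolutely_continuous_def
  proof
    fix N :: "real set" assume N: "N \<in> null_sets lborel"
    have "N \<inter> {- real (Suc m)..real (Suc m)} \<in> null_sets \<nu>" for m
    proof -
      have N': "N \<inter> {- real (Suc m)..real (Suc m)} \<in> null_sets lborel"
        using N by (rule null_set_Int2) auto
      have le: "emeasure \<nu> (N \<inter> {- real (Suc m)..real (Suc m)}) \<le> ennreal \<epsilon>" if "\<epsilon> > 0" for \<epsilon>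
        unfolding \<nu>_def
        by (rule interval_measure_null_of_abs_cont[OF F mono N' _ _ that]) auto
      have "emeasure \<nu> (N \<inter> {- real (Suc m)..real (Suc m)}) \<le> 0"
      proof (rule ennreal_le_epsilon)
        fix e :: real assume "0 < e"
        from le[OF this] show "emeasure \<nu> (N \<inter> {- real (Suc m)..real (Suc m)}) \<le> 0 + ennreal e" by simp
      qed
      then have "emeasure \<nu> (N \<inter> {- real (Suc m)..real (Suc m)}) = 0" by simp
      then show ?thesis using N' by (intro null_setsI) auto
    qed
    then have "(\<Union>m. N \<inter> {- real (Suc m)..real (Suc m)}) \<in> null_sets \<nu>"
      by (rule null_sets_UN)
    moreover have "(\<Union>m. N \<inter> {- real (Suc m)..real (Suc m)}) = N"
    proof -
      have "\<exists>m. x \<in> {- real (Suc m)..real (Suc m)}" for x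
      proof -
        obtain n where "\<bar>x\<bar> < real n" using reals_Archimedean2 by blast
        then show ?thesis by (intro exI[of _ n]) auto
      qed
      then show ?thesis by blast
    qed
    ultimately show "N \<in> null_sets \<nu>" by simp
  qed
  obtain f where f[measurable]: "f \<in> borel_measurable lborel" and dens: "density lborel f = \<nu>"
    using sigma_finite_measure.Radon_Nikodym[OF lborel.sigma_finite_measure_axioms ac] by auto
  have em: "emeasure \<nu> A = (\<integral>\<^sup>+x. f x * indicator A x \<partial>lborel)" if "A \<in> sets borel" for A
    using that unfolding dens[symmetric] by (simp add: emeasure_density)
  have ftop: "(\<integral>\<^sup>+x. f x \<partial>lborel) \<noteq> \<infinity>"
    using em[of UNIV] fin by simp
  have AEf: "AE x in lborel. f x \<noteq> \<infinity>"
    by (rule nn_integral_PInf_AE[OF _ ftop]) simp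
  define g where "g x = enn2real (f x)" for x
  have [measurable]: "g \<in> borel_measurable lborel" unfolding g_def by measurable
  have gf: "AE x in lborel. ennreal (g x) = f x"
    using AEf by eventually_elim (auto simp: g_def less_top)
  have int: "integrable lborel g"
  proof (rule integrableI_nonneg)
    have "(\<integral>\<^sup>+x. ennreal (g x) \<partial>lborel) = (\<integral>\<^sup>+x. f x \<partial>lborel)"
      using gf by (rule nn_integral_cong_AE)
    then show "(\<integral>\<^sup>+x. ennreal (g x) \<partial>lborel) < \<infinity>" using ftop by (simp add: less_top)
  qed (auto simp: g_def)
  show ?thesis
  proof (intro exI[of _ g] conjI allI impI int)
    fix u v :: real assume uv: "u \<le> v"
    have "ennreal (F v - F u) = (\<integral>\<^sup>+x. f x * indicator {u..v} x \<partial>lborel)"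
      using Icc[OF uv] em[of "{u..v}"] by simp
    also have "\<dots> = (\<integral>\<^sup>+x. ennreal (indicator {u..v} x * g x) \<partial>lborel)"
      using gf by (intro nn_integral_cong_AE) (auto simp: indicator_def elim!: eventually_mono)
    also have "\<dots> = ennreal (LBINT t:{u..v}. g t)"
      unfolding set_lebesgue_integral_def
    proof (subst nn_integral_eq_integral)
      show "integrable lborel (\<lambda>x. indicator {u..v} x * g x)"
        using integrable_mult_indicator[OF _ int, of "{u..v}"] by simp
    qed (auto simp: g_def)
    finally show "F v - F u = (LBINT t:{u..v}. g t)"
      using mono[OF uv]
      by (subst (asm) ennreal_inj) (auto simp: set_lebesgue_integral_def g_def intro!: integral_nonneg_AE)
  qed
qed

section \<open>The Lebesgue differentiation theorem\<close>

text \<open>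
  The upper half of the Lebesgue differentiation theorem: where \<open>g < p < q\<close>, averages of \<open>g\<close> over small
  intervals around almost every point are at most \<open>q\<close>; the lower half is the same statement for \<open>- g\<close>.

  Let \<open>E\<close> be a bounded piece of the exceptional set and split \<open>h = g - q\<close> into the finite measures \<open>\<kappa>p\<close>
  (density \<open>h\<^sup>+\<close>) and \<open>\<kappa>m\<close> (density \<open>h\<^sup>-\<close>). Since \<open>h < 0\<close> on \<open>E\<close>, some open \<open>U\<close> containing \<open>E\<close> has \<open>\<kappa>p U \<le> \<epsilon>\<close>.
  By the Vitali covering theorem \<open>E\<close> is covered, up to a null set, by disjoint intervals inside \<open>U\<close> on
  which the integral of \<open>h\<close> is positive. Summing over them,
  \<open>(q - p) * \<lambda>(E) \<le> \<kappa>m E \<le> \<kappa>p U \<le> \<epsilon>\<close>, where \<open>\<lambda>\<close> is Lebesgue measure.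
\<close>

lemma AE_interval_average_le:
  fixes g :: "real \<Rightarrow> real"
  assumes g: "integrable lborel g" and pq: "p < q"
  shows "AE x in lborel. g x < p \<longrightarrow>
    (\<exists>\<delta>>0. \<forall>u v. u < x \<and> x < v \<and> v - u < \<delta> \<longrightarrow> (LBINT t:{u..v}. g t) \<le> q * (v - u))"
proof -
  have [measurable]: "g \<in> borel_measurable borel"
    using g by auto
  define big where "big u v \<longleftrightarrow> (LBINT t:{u..v}. g t) > q * (v - u)" for u v
  define G where "G k = \<Union>{{u<..<v} | u v. v - u < inverse (real (Suc k)) \<and> big u v}" for k
  define B where "B = {x. g x < p} \<inter> (\<Inter>k. G k)"
  have "open (G k)" for k
    unfolding G_def by (rule open_Union) auto
  then have [measurable]: "G k \<in> sets borel" for k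
    by auto
  have B[measurable]: "B \<in> sets borel"
    unfolding B_def by measurable
  have null: "B \<inter> {- real M<..<real M} \<in> null_sets lborel" for M :: nat
  proof -
    define J where "J = {- real M<..<real M}"
    define E where "E = B \<inter> J"
    have [measurable]: "J \<in> sets borel" "E \<in> sets borel"
      by (auto simp: J_def E_def)
    define h where "h x = g x - q" for x
    have [measurable]: "h \<in> borel_measurable borel"
      unfolding h_def by measurable
    have hJ: "set_integrable lborel A h" if "A \<subseteq> {- real M.. real M}" "A \<in> sets borel" for A
    proof -
      have "set_integrable lborel A g" "set_integrable lborel A (\<lambda>_. q)"
      proof -
        show "set_integrable lborel A g"
          unfolding set_integrable_def
          using that by (intro integrable_mult_indicator g) auto
        show "set_integrable lborel A (\<lambda>_. q)"
          by (rule set_integrable_subset[where A="{- real M.. real M}"])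
             (use that in \<open>auto simp: set_integrable_def\<close>)
      qed
      then show ?thesis
        unfolding h_def by (rule set_integral_diff)
    qed
    define \<kappa>p where "\<kappa>p = density lborel (\<lambda>x. ennreal (indicator J x * h x))"
    define \<kappa>m where "\<kappa>m = density lborel (\<lambda>x. ennreal (- (indicator J x * h x)))"
    have sets\<kappa>[measurable_cong, simp]: "sets \<kappa>p = sets borel" "sets \<kappa>m = sets borel"
      by (simp_all add: \<kappa>p_def \<kappa>m_def)
    have em: "emeasure \<kappa>p A = (\<integral>\<^sup>+x. ennreal (indicator A x * h x) \<partial>lborel)"
             "emeasure \<kappa>m A = (\<integral>\<^sup>+x. ennreal (- (indicator A x * h x)) \<partial>lborel)"
      if "A \<subseteq> J" "A \<in> sets borel" for A
      using that unfolding \<kappa>p_def \<kappa>m_def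
      by (auto simp: emeasure_density indicator_def intro!: nn_integral_cong)
    have "emeasure \<kappa>p UNIV < \<infinity>"
    proof -
      have "emeasure \<kappa>p UNIV = (\<integral>\<^sup>+x. ennreal (indicator J x * h x) \<partial>lborel)"
        by (simp add: \<kappa>p_def emeasure_density)
      also have "\<dots> < \<infinity>"
      proof -
        have "integrable lborel (\<lambda>x. indicator J x * h x)"
          using hJ[of J] by (simp add: J_def set_integrable_def subset_eq)
        then show ?thesis
          by (auto simp: real_integrable_def less_top)
      qed
      finally show ?thesis .
    qed
    then have finp: "emeasure \<kappa>p (space \<kappa>p) \<noteq> \<infinity>"
      by (simp add: \<kappa>p_def)
    have E0: "emeasure \<kappa>p E = 0"
    proof -
      have "emeasure \<kappa>p E = (\<integral>\<^sup>+x. 0 \<partial>lborel)"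
      proof -
        have "E \<subseteq> J" "E \<in> sets borel" by (auto simp: E_def)
        moreover have "ennreal (indicator E x * h x) = 0" for x
          using pq by (auto simp: E_def B_def h_def indicator_def intro!: ennreal_neg)
        ultimately show ?thesis by (simp add: em(1))
      qed
      then show ?thesis by simp
    qed
    have bound: "ennreal (q - p) * emeasure lborel E \<le> ennreal \<epsilon>" if "\<epsilon> > 0" for \<epsilon>
    proof -
      have "(INF U\<in>{U. E \<subseteq> U \<and> open U}. emeasure \<kappa>p U) < ennreal \<epsilon>"
        using outer_regular[of \<kappa>p E, OF _ finp] E0 \<open>\<epsilon> > 0\<close> by auto
      then obtain U0 where U0: "E \<subseteq> U0" "open U0" "emeasure \<kappa>p U0 < ennreal \<epsilon>"
        by (auto simp: INF_less_iff)
      define U where "U = U0 \<inter> J"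
      have U: "E \<subseteq> U" "open U" "U \<subseteq> J"
        using U0 by (auto simp: U_def E_def J_def)
      have \<kappa>U: "emeasure \<kappa>p U \<le> ennreal \<epsilon>"
      proof -
        have "emeasure \<kappa>p U \<le> emeasure \<kappa>p U0"
          using U0 by (intro emeasure_mono) (auto simp: U_def)
        then show ?thesis using U0 by auto
      qed
      define K where "K = {(u, v). u < v \<and> {u..v} \<subseteq> U \<and> big u v}"
      define a where "a = (\<lambda>(u, v). (u + v) / 2 :: real)"
      define r where "r = (\<lambda>(u, v). (v - u) / 2 :: real)"
      have cb: "cball (a i) (r i) = {fst i..snd i}" for i
        by (cases i) (simp add: a_def r_def cball_eq_atLeastAtMost field_simps)
      obtain C where C: "countable C" "C \<subseteq> K"
        and disj: "pairwise (\<lambda>i j. disjnt (cball (a i) (r i)) (cball (a j) (r j))) C"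
        and negl: "negligible (E - (\<Union>i\<in>C. cball (a i) (r i)))"
      proof (rule Vitali_covering_theorem_cballs[of K r E a])
        show "0 < r i" if "i \<in> K" for i
          using that by (auto simp: K_def r_def)
        fix x d :: real assume x: "x \<in> E" "0 < d"
        then have "x \<in> U" using U by auto
        then obtain e where e: "e > 0" "ball x e \<subseteq> U"
          using \<open>open U\<close> open_contains_ball by blast
        obtain k where k: "inverse (real (Suc k)) < min d e"
          using reals_Archimedean[of "min d e"] e x by auto
        from x have "x \<in> G k" by (auto simp: E_def B_def)
        then obtain u v where uv: "u < x" "x < v" "v - u < inverse (real (Suc k))" "big u v"
          by (auto simp: G_def)
        have "{u..v} \<subseteq> ball x e"
          using uv k by (auto simp: dist_real_def)
        then have "(u, v) \<in> K" using e uv by (auto simp: K_def)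
        moreover have "x \<in> cball (a (u, v)) (r (u, v))" using uv by (subst cb) auto
        moreover have "r (u, v) < d" using uv k x by (auto simp: r_def)
        ultimately show "\<exists>i. i \<in> K \<and> x \<in> cball (a i) (r i) \<and> r i < d" by blast
      qed blast
      define V where "V = (\<Union>i\<in>C. cball (a i) (r i))"
      have V[measurable]: "V \<in> sets borel"
        unfolding V_def using C by (intro sets.countable_UN') auto
      have VU: "V \<subseteq> U"
        using C by (fastforce simp: V_def cb K_def)
      have le: "emeasure \<kappa>m (cball (a i) (r i)) \<le> emeasure \<kappa>p (cball (a i) (r i))" if i: "i \<in> C" for i
      proof -
        obtain u v where uv: "i = (u, v)" using prod.exhaust by blast
        from i C have *: "u < v" "{u..v} \<subseteq> U" "big u v" by (auto simp: K_def uv)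
        have sub: "{u..v} \<subseteq> J" using * U by auto
        then have int: "integrable lborel (\<lambda>x. indicator {u..v} x * h x)"
          using hJ[of "{u..v}"] by (force simp: J_def set_integrable_def)
        have gi: "set_integrable lborel {u..v} g"
          unfolding set_integrable_def by (intro integrable_mult_indicator g) auto
        have "(LBINT t:{u..v}. h t) = (LBINT t:{u..v}. g t) - (LBINT t:{u..v}. q)"
          unfolding h_def by (rule set_integral_diff[OF gi])
            (rule borel_integrable_atLeastAtMost', simp)
        also have "(LBINT t:{u..v}. q) = q * (v - u)"
          using * by (simp add: set_lebesgue_integral_def)
        finally have "(LBINT t:{u..v}. h t) > 0"
          using * by (simp add: big_def)
        then have pos: "integral\<^sup>L lborel (\<lambda>x. indicator {u..v} x * h x) > 0"
          by (simp add: set_lebesgue_integral_def)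
        let ?p = "\<integral>\<^sup>+x. ennreal (indicator {u..v} x * h x) \<partial>lborel"
        let ?m = "\<integral>\<^sup>+x. ennreal (- (indicator {u..v} x * h x)) \<partial>lborel"
        have fin: "?p \<noteq> \<infinity>" "?m \<noteq> \<infinity>"
          using int unfolding real_integrable_def by auto
        have "enn2real ?p - enn2real ?m > 0"
          using pos real_lebesgue_integral_def[OF int] by simp
        then have "enn2real ?m \<le> enn2real ?p" by simp
        then have "?m \<le> ?p"
          using fin by (metis ennreal_enn2real ennreal_leI infinity_ennreal_def less_top)
        then show ?thesis
          using em[OF sub] by (simp add: cb uv)
      qed
      have disj': "disjoint_family_on (\<lambda>i. cball (a i) (r i)) C"
        using disj by (auto simp: disjoint_family_on_def pairwise_def disjnt_def)
      have "emeasure \<kappa>m V \<le> emeasure \<kappa>p V"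
      proof -
        have "emeasure \<kappa>m V = (\<integral>\<^sup>+i. emeasure \<kappa>m (cball (a i) (r i)) \<partial>count_space C)"
          unfolding V_def using C disj' by (intro emeasure_UN_countable) auto
        also have "\<dots> \<le> (\<integral>\<^sup>+i. emeasure \<kappa>p (cball (a i) (r i)) \<partial>count_space C)"
          using le by (intro nn_integral_mono) auto
        also have "\<dots> = emeasure \<kappa>p V"
          unfolding V_def using C disj' by (intro emeasure_UN_countable[symmetric]) auto
        finally show ?thesis .
      qed
      also have "\<dots> \<le> emeasure \<kappa>p U"
        using VU U by (intro emeasure_mono) auto
      also note \<kappa>U
      finally have mV: "emeasure \<kappa>m V \<le> ennreal \<epsilon>" .
      have "E - V \<in> null_sets lborel"
      proof -
        have "E - V \<in> null_sets lebesgue"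
          using negl by (simp add: V_def negligible_iff_null_sets)
        then show ?thesis
          by (simp add: null_sets_def)
      qed
      moreover have "absolutely_continuous lborel \<kappa>m"
        unfolding \<kappa>m_def by (rule absolutely_continuousI_density) measurable
      ultimately have "E - V \<in> null_sets \<kappa>m"
        by (auto simp: absolutely_continuous_def)
      then have "emeasure \<kappa>m E = emeasure \<kappa>m (E - (E - V))"
        by (intro emeasure_Diff_null_set[symmetric]) auto
      also have "\<dots> \<le> emeasure \<kappa>m V"
        by (intro emeasure_mono) auto
      also note mV
      finally have mE: "emeasure \<kappa>m E \<le> ennreal \<epsilon>" .
      have "ennreal (q - p) * emeasure lborel E = (\<integral>\<^sup>+x. ennreal (q - p) * indicator E x \<partial>lborel)"
        by (subst nn_integral_cmult_indicator) (simp_all add: E_def J_def)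
      also have "\<dots> \<le> (\<integral>\<^sup>+x. ennreal (- (indicator E x * h x)) \<partial>lborel)"
        by (intro nn_integral_mono) (auto simp: E_def B_def h_def indicator_def intro!: ennreal_leI)
      also have "\<dots> = emeasure \<kappa>m E"
        by (rule em(2)[symmetric]) (auto simp: E_def)
      finally show ?thesis using mE by simp
    qed
    have "ennreal (q - p) * emeasure lborel E = 0"
    proof (rule ccontr)
      assume "ennreal (q - p) * emeasure lborel E \<noteq> 0"
      then have "0 < ennreal (q - p) * emeasure lborel E"
        by (simp add: zero_less_iff_neq_zero)
      then obtain z where z: "0 < z" "z < ennreal (q - p) * emeasure lborel E"
        using dense by blast
      with bound[of "enn2real z"] show False
        by (metis enn2real_positive_iff ennreal_enn2real less_top less_trans not_le order_less_le_trans top_greatest)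
    qed
    then have "emeasure lborel E = 0"
      using pq by simp
    then show ?thesis
      by (simp add: null_sets_def E_def J_def)
  qed
  have "B = (\<Union>M. B \<inter> {- real M<..<real M})"
  proof -
    have "\<exists>M. x \<in> {- real M<..<real M}" for x
    proof -
      obtain n where "\<bar>x\<bar> < real n" using reals_Archimedean2 by blast
      then show ?thesis by (intro exI[of _ n]) auto
    qed
    then show ?thesis by blast
  qed
  also have "\<dots> \<in> null_sets lborel"
    by (rule null_sets_UN[OF null])
  finally have "B \<in> null_sets lborel" .
  then show ?thesis
  proof (rule AE_I')
    show "{x \<in> space lborel. \<not> (g x < p \<longrightarrow> (\<exists>\<delta>>0. \<forall>u v. u < x \<and> x < v \<and> v - u < \<delta> \<longrightarrow>
        (LBINT t:{u..v}. g t) \<le> q * (v - u)))} \<subseteq> B"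
    proof
      fix x assume "x \<in> {x \<in> space lborel. \<not> (g x < p \<longrightarrow> (\<exists>\<delta>>0. \<forall>u v. u < x \<and> x < v \<and> v - u < \<delta> \<longrightarrow>
        (LBINT t:{u..v}. g t) \<le> q * (v - u)))}"
      then have x: "g x < p"
        and no: "\<not> (\<exists>\<delta>>0. \<forall>u v. u < x \<and> x < v \<and> v - u < \<delta> \<longrightarrow> (LBINT t:{u..v}. g t) \<le> q * (v - u))"
        by auto
      have "x \<in> G k" for k
      proof -
        have "inverse (real (Suc k)) > 0" by simp
        with no obtain u v where uv: "u < x" "x < v" "v - u < inverse (real (Suc k))" "big u v"
          unfolding big_def not_le[symmetric] by blast
        show ?thesis
          unfolding G_def
        proof (rule UnionI)
          show "{u<..<v} \<in> {{u<..<v} | u v. v - u < inverse (real (Suc k)) \<and> big u v}"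
            using uv by blast
          show "x \<in> {u<..<v}" using uv by simp
        qed
      qed
      with x show "x \<in> B" by (auto simp: B_def)
    qed
  qed
qed

section \<open>The fundamental theorem of calculus for absolutely continuous functions\<close>

lemma abs_cont_path_eq_integral:
  assumes F: "abs_cont F" and left: "\<And>x. x \<le> 0 \<Longrightarrow> F x = F 0" and right: "\<And>x. 1 \<le> x \<Longrightarrow> F x = F 1"
  shows "\<exists>g. integrable lborel g \<and> (\<forall>u v. u \<le> v \<longrightarrow> F v - F u = (LBINT t:{u..v}. g t))"
proof -
  interpret abs_cont_path F
    by (rule abs_cont_path.intro[OF F left right])
  let ?P = "pos_variation F" and ?N = "\<lambda>x. pos_variation F x - F x"
  obtain p where p: "integrable lborel p" "\<And>u v. u \<le> v \<Longrightarrow> ?P v - ?P u = (LBINT t:{u..v}. p t)"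
    using mono_abs_cont_eq_integral[OF abs_cont_pos_variation pos_variation_mono pos_variation_left pos_variation_right]
    by blast
  have "\<exists>n. integrable lborel n \<and> (\<forall>u v. u \<le> v \<longrightarrow> ?N v - ?N u = (LBINT t:{u..v}. n t))"
  proof (rule mono_abs_cont_eq_integral)
    show "abs_cont ?N" by (rule abs_cont_diff[OF abs_cont_pos_variation F])
    show "?N x \<le> ?N y" if "x \<le> y" for x y
      using pos_variation_increment[OF that] by simp
    show "?N x = ?N 0" if "x \<le> 0" for x
      using pos_variation_left[OF that] left[OF that] by simp
    show "?N x = ?N 1" if "1 \<le> x" for x
      using pos_variation_right[OF that] right[OF that] by simp
  qed
  then obtain n where n: "integrable lborel n" "\<And>u v. u \<le> v \<Longrightarrow> ?N v - ?N u = (LBINT t:{u..v}. n t)"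
    by blast
  have si: "set_integrable lborel {u..v} f" if "integrable lborel f" for f :: "real \<Rightarrow> real" and u v
    unfolding set_integrable_def using that by (intro integrable_mult_indicator) auto
  show ?thesis
  proof (intro exI[of _ "\<lambda>x. p x - n x"] conjI allI impI)
    show "integrable lborel (\<lambda>x. p x - n x)" using p n by simp
    fix u v :: real assume uv: "u \<le> v"
    have "F v - F u = (?P v - ?P u) - (?N v - ?N u)" by simp
    also have "\<dots> = (LBINT t:{u..v}. p t - n t)"
      unfolding p(2)[OF uv] n(2)[OF uv] by (rule set_integral_diff(2)[OF si[OF p(1)] si[OF n(1)], symmetric])
    finally show "F v - F u = (LBINT t:{u..v}. p t - n t)" .
  qed
qed

text \<open>
  The almost everywhere bounds are applied with all rational pairs \<open>r < s\<close> at once. They concern intervals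
  that contain \<open>x\<close> in their interior; continuity of \<open>F\<close> extends them to intervals with end point \<open>x\<close>.
\<close>

lemma indefinite_integral_has_derivative_AE:
  fixes g :: "real \<Rightarrow> real"
  assumes g: "integrable lborel g"
    and F: "\<And>u v. u \<le> v \<Longrightarrow> F v - F u = (LBINT t:{u..v}. g t)" and cont: "continuous_on UNIV F"
  shows "AE x in lborel. (F has_real_derivative g x) (at x)"
proof -
  have neg: "integrable lborel (\<lambda>x. - g x)" using g by simp
  have "AE x in lborel. \<forall>r\<in>\<rat>. \<forall>s\<in>\<rat>. r < s \<longrightarrow> g x < r \<longrightarrow>
    (\<exists>\<delta>>0. \<forall>u v. u < x \<and> x < v \<and> v - u < \<delta> \<longrightarrow> (LBINT t:{u..v}. g t) \<le> s * (v - u))"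
    using AE_interval_average_le[OF g] by (auto simp: AE_ball_countable[OF countable_rat])
  moreover have "AE x in lborel. \<forall>r\<in>\<rat>. \<forall>s\<in>\<rat>. r < s \<longrightarrow> - g x < r \<longrightarrow>
    (\<exists>\<delta>>0. \<forall>u v. u < x \<and> x < v \<and> v - u < \<delta> \<longrightarrow> (LBINT t:{u..v}. - g t) \<le> s * (v - u))"
    using AE_interval_average_le[OF neg] by (auto simp: AE_ball_countable[OF countable_rat])
  ultimately show ?thesis
  proof eventually_elim
    case (elim x)
    have up: "\<exists>\<delta>>0. \<forall>u v. u < x \<and> x < v \<and> v - u < \<delta> \<longrightarrow> F v - F u \<le> (g x + e) * (v - u)" if e: "e > 0" for e
    proof -
      obtain r where r: "r \<in> \<rat>" "g x < r" "r < g x + e" using Rats_dense_in_real[of "g x" "g x + e"] e by auto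
      obtain s where s: "s \<in> \<rat>" "r < s" "s < g x + e" using Rats_dense_in_real[of r "g x + e"] r by auto
      obtain \<delta> where \<delta>: "\<delta> > 0" "\<And>u v. u < x \<Longrightarrow> x < v \<Longrightarrow> v - u < \<delta> \<Longrightarrow> (LBINT t:{u..v}. g t) \<le> s * (v - u)"
        using elim(1)[rule_format, OF r(1) s(1) s(2) r(2)] by metis
      have "F v - F u \<le> (g x + e) * (v - u)" if "u < x" "x < v" "v - u < \<delta>" for u v
      proof -
        have "F v - F u \<le> s * (v - u)" using \<delta>(2)[OF that] F[of u v] that by simp
        also have "\<dots> \<le> (g x + e) * (v - u)" using s that by (intro mult_right_mono) auto
        finally show ?thesis .
      qed
      with \<delta>(1) show ?thesis by blast
    qed
    have low: "\<exists>\<delta>>0. \<forall>u v. u < x \<and> x < v \<and> v - u < \<delta> \<longrightarrow> (g x - e) * (v - u) \<le> F v - F u" if e: "e > 0" for e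
    proof -
      obtain r where r: "r \<in> \<rat>" "- g x < r" "r < - g x + e" using Rats_dense_in_real[of "- g x" "- g x + e"] e by auto
      obtain s where s: "s \<in> \<rat>" "r < s" "s < - g x + e" using Rats_dense_in_real[of r "- g x + e"] r by auto
      obtain \<delta> where \<delta>: "\<delta> > 0" "\<And>u v. u < x \<Longrightarrow> x < v \<Longrightarrow> v - u < \<delta> \<Longrightarrow> (LBINT t:{u..v}. - g t) \<le> s * (v - u)"
        using elim(2)[rule_format, OF r(1) s(1) s(2) r(2)] by metis
      have "(g x - e) * (v - u) \<le> F v - F u" if "u < x" "x < v" "v - u < \<delta>" for u v
      proof -
        have "(LBINT t:{u..v}. - g t) = - (LBINT t:{u..v}. g t)"
          by (simp add: set_lebesgue_integral_def)
        then have "- (F v - F u) \<le> s * (v - u)" using \<delta>(2)[OF that] F[of u v] that by simp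
        also have "\<dots> \<le> (- g x + e) * (v - u)" using s that by (intro mult_right_mono) auto
        finally show ?thesis by (simp add: algebra_simps)
      qed
      with \<delta>(1) show ?thesis by blast
    qed
    have main: "\<exists>\<delta>>0. \<forall>u v. u < v \<and> u \<le> x \<and> x \<le> v \<and> v - u < \<delta> \<longrightarrow> \<bar>F v - F u - g x * (v - u)\<bar> \<le> e * (v - u)" if e: "e > 0" for e
    proof -
      obtain \<delta>1 where \<delta>1: "\<delta>1 > 0" "\<And>u v. u < x \<Longrightarrow> x < v \<Longrightarrow> v - u < \<delta>1 \<Longrightarrow> F v - F u \<le> (g x + e) * (v - u)"
        using up[OF e] by blast
      obtain \<delta>2 where \<delta>2: "\<delta>2 > 0" "\<And>u v. u < x \<Longrightarrow> x < v \<Longrightarrow> v - u < \<delta>2 \<Longrightarrow> (g x - e) * (v - u) \<le> F v - F u"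
        using low[OF e] by blast
      have "\<bar>F v - F u - g x * (v - u)\<bar> \<le> e * (v - u)"
        if uv: "u < v" "u \<le> x" "x \<le> v" "v - u < min \<delta>1 \<delta>2" for u v
      proof -
        define U where "U k = u - inverse (real (Suc k))" for k
        define V where "V k = v + inverse (real (Suc k))" for k
        have 0: "(\<lambda>k. inverse (real (Suc k))) \<longlonglongrightarrow> 0" by (rule LIMSEQ_inverse_real_of_nat)
        have U: "U \<longlonglongrightarrow> u" unfolding U_def using tendsto_diff[OF tendsto_const 0, of u] by simp
        have V: "V \<longlonglongrightarrow> v" unfolding V_def using tendsto_add[OF tendsto_const 0, of v] by simp
        have FU: "(\<lambda>k. F (U k)) \<longlonglongrightarrow> F u"
          using continuous_on_tendsto_compose[OF cont U] by simp
        have FV: "(\<lambda>k. F (V k)) \<longlonglongrightarrow> F v"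
          using continuous_on_tendsto_compose[OF cont V] by simp
        have "(\<lambda>k. V k - U k) \<longlonglongrightarrow> v - u" by (intro tendsto_intros U V)
        then have "\<forall>\<^sub>F k in sequentially. V k - U k < min \<delta>1 \<delta>2"
          by (rule order_tendstoD(2)[OF _ uv(4)])
        then have ev: "\<forall>\<^sub>F k in sequentially. \<bar>F (V k) - F (U k) - g x * (V k - U k)\<bar> \<le> e * (V k - U k)"
        proof eventually_elim
          case (elim k)
          have pos: "inverse (real (Suc k)) > 0" by simp
          then have "U k < x" "x < V k" using uv by (auto simp: U_def V_def simp del: inverse_positive_iff_positive)
          then show ?case using \<delta>1(2)[of "U k" "V k"] \<delta>2(2)[of "U k" "V k"] elim
            by (auto simp: abs_le_iff algebra_simps)
        qed
        have L: "(\<lambda>k. \<bar>F (V k) - F (U k) - g x * (V k - U k)\<bar>) \<longlonglongrightarrow> \<bar>F v - F u - g x * (v - u)\<bar>"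
          by (intro tendsto_rabs tendsto_diff tendsto_mult tendsto_const FU FV U V)
        have R: "(\<lambda>k. e * (V k - U k)) \<longlonglongrightarrow> e * (v - u)"
          by (intro tendsto_diff tendsto_mult tendsto_const U V)
        show ?thesis by (rule tendsto_le[OF trivial_limit_sequentially R L ev])
      qed
      then show ?thesis using \<delta>1(1) \<delta>2(1) by (intro exI[of _ "min \<delta>1 \<delta>2"]) auto
    qed
    show "(F has_real_derivative g x) (at x)"
      unfolding has_field_derivative_iff LIM_def
    proof (intro allI impI)
      fix e :: real assume "e > 0"
      then have e2: "e / 2 > 0" by simp
      obtain \<delta> where \<delta>: "\<delta> > 0" "\<And>u v. u < v \<Longrightarrow> u \<le> x \<Longrightarrow> x \<le> v \<Longrightarrow> v - u < \<delta> \<Longrightarrow> \<bar>F v - F u - g x * (v - u)\<bar> \<le> e / 2 * (v - u)"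
        using main[OF e2] by blast
      show "\<exists>d>0. \<forall>y. y \<noteq> x \<and> dist y x < d \<longrightarrow> dist ((F y - F x) / (y - x)) (g x) < e"
      proof (intro exI[of _ \<delta>] conjI allI impI \<delta>(1))
        fix y assume y: "y \<noteq> x \<and> dist y x < \<delta>"
        have "\<bar>F y - F x - g x * (y - x)\<bar> \<le> e / 2 * \<bar>y - x\<bar>"
        proof (cases "x < y")
          case True
          then show ?thesis using \<delta>(2)[of x y] y by (simp add: dist_real_def)
        next
          case False
          then have "y < x" using y by simp
          then have "\<bar>F x - F y - g x * (x - y)\<bar> \<le> e / 2 * (x - y)"
            using \<delta>(2)[of y x] y by (simp add: dist_real_def)
          moreover have "F x - F y - g x * (x - y) = - (F y - F x - g x * (y - x))" by (simp add: algebra_simps)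
          ultimately show ?thesis using \<open>y < x\<close> by (simp only: abs_minus_cancel) simp
        qed
        moreover have "(F y - F x) / (y - x) - g x = (F y - F x - g x * (y - x)) / (y - x)"
          using y by (simp add: field_simps)
        ultimately have "\<bar>(F y - F x) / (y - x) - g x\<bar> \<le> e / 2"
          using y by (simp add: abs_divide divide_le_eq)
        then show "dist ((F y - F x) / (y - x)) (g x) < e"
          using \<open>e > 0\<close> by (simp add: dist_real_def)
      qed
    qed
  qed
qed

section \<open>The action of a path\<close>

text \<open>
  The nearest-point projection of the line onto \<open>[0,1]\<close>.
\<close>

definition clamp01 :: "real \<Rightarrow> real" where
  "clamp01 t = max 0 (min 1 t)"

lemma clamp01_simps [simp]: "x \<le> 0 \<Longrightarrow> clamp01 x = 0" "1 \<le> x \<Longrightarrow> clamp01 x = 1"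
  "0 \<le> x \<Longrightarrow> x \<le> 1 \<Longrightarrow> clamp01 x = x"
  by (auto simp: clamp01_def)

lemma mono_clamp01: "mono clamp01"
  by (auto simp: mono_def clamp01_def)

lemma abs_cont_clamp:
  assumes "absolutely_continuous_fun 0 1 \<omega>"
  shows "abs_cont (\<lambda>t. \<omega> (clamp01 t))"
  unfolding abs_cont_def
proof (intro allI impI)
  fix \<epsilon> :: real assume "\<epsilon> > 0"
  then obtain \<delta> where \<delta>: "\<delta> > 0" and *: "\<And>I :: (real \<times> real) set. finite I \<Longrightarrow>
        (\<forall>(u, v)\<in>I. 0 \<le> u \<and> u \<le> v \<and> v \<le> 1) \<Longrightarrow>
        disjoint_family_on (\<lambda>(u, v). {u<..<v}) I \<Longrightarrow>
        (\<Sum>(u, v)\<in>I. v - u) < \<delta> \<Longrightarrow> (\<Sum>(u, v)\<in>I. \<bar>\<omega> v - \<omega> u\<bar>) < \<epsilon>"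
    using assms unfolding absolutely_continuous_fun_def by meson
  show "\<exists>\<delta>>0. \<forall>I. interval_family I \<longrightarrow> total_length I < \<delta> \<longrightarrow>
     (\<Sum>(u, v)\<in>I. \<bar>\<omega> (clamp01 v) - \<omega> (clamp01 u)\<bar>) < \<epsilon>"
  proof (intro exI[of _ \<delta>] conjI allI impI \<delta>)
    fix I assume I: "interval_family I" "total_length I < \<delta>"
    let ?J = "map_prod clamp01 clamp01 ` I"
    have J: "interval_family ?J" by (rule interval_family_map[OF I(1) mono_clamp01])
    have s: "(\<Sum>p\<in>?J. g p) = (\<Sum>(u, v)\<in>I. g (clamp01 u, clamp01 v))" if "\<And>x. g (x, x) = 0" for g :: "real \<times> real \<Rightarrow> real"
      by (rule sum_interval_family_map[OF I(1) mono_clamp01]) (rule that)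
    have "(\<Sum>(u, v)\<in>?J. \<bar>\<omega> v - \<omega> u\<bar>) < \<epsilon>"
    proof (rule *)
      show "finite ?J" "disjoint_family_on (\<lambda>(u, v). {u<..<v}) ?J"
        using J by (simp_all add: interval_family_def)
      show "\<forall>(u, v)\<in>?J. 0 \<le> u \<and> u \<le> v \<and> v \<le> 1"
      proof
        fix p assume p: "p \<in> ?J"
        then have "0 \<le> fst p" "snd p \<le> 1" by (auto simp: clamp01_def)
        with interval_familyD(2)[OF J p] show "case p of (u, v) \<Rightarrow> 0 \<le> u \<and> u \<le> v \<and> v \<le> 1"
          by (simp add: split_beta)
      qed
      have "(\<Sum>(u, v)\<in>?J. v - u) = (\<Sum>(u, v)\<in>I. clamp01 v - clamp01 u)"
        by (subst s) simp_all
      also have "\<dots> \<le> total_length I"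
        unfolding total_length_def
      proof (rule sum_mono)
        fix p assume "p \<in> I"
        then have "fst p \<le> snd p" by (rule interval_familyD(2)[OF I(1)])
        then show "(case p of (u, v) \<Rightarrow> clamp01 v - clamp01 u) \<le> (case p of (u, v) \<Rightarrow> v - u)"
          by (auto simp: split_beta clamp01_def)
      qed
      finally show "(\<Sum>(u, v)\<in>?J. v - u) < \<delta>" using I(2) by simp
    qed
    then show "(\<Sum>(u, v)\<in>I. \<bar>\<omega> (clamp01 v) - \<omega> (clamp01 u)\<bar>) < \<epsilon>"
      by (subst (asm) s) simp_all
  qed
qed

lemma ennreal_integral_le_nn_integral:
  fixes f :: "'a \<Rightarrow> real"
  assumes "integrable M f"
  shows "ennreal (integral\<^sup>L M f) \<le> (\<integral>\<^sup>+x. ennreal (f x) \<partial>M)"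
proof -
  have fin: "(\<integral>\<^sup>+x. ennreal (f x) \<partial>M) \<noteq> \<infinity>"
    using assms by (simp add: real_integrable_def)
  have "integral\<^sup>L M f \<le> enn2real (\<integral>\<^sup>+x. ennreal (f x) \<partial>M)"
    using real_lebesgue_integral_def[OF assms] by simp
  then have "ennreal (integral\<^sup>L M f) \<le> ennreal (enn2real (\<integral>\<^sup>+x. ennreal (f x) \<partial>M))"
    by (rule ennreal_leI)
  also have "\<dots> = (\<integral>\<^sup>+x. ennreal (f x) \<partial>M)"
    using fin by (simp add: less_top)
  finally show ?thesis .
qed

text \<open>
  A path with a given displacement has at least the action of the motion with constant speed.
\<close>

lemma path_action_ge:
  "ennreal (1/2 * (\<omega> 1 - \<omega> 0)\<^sup>2) \<le> path_action \<omega>"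
proof (cases "absolutely_continuous_fun 0 1 \<omega>")
  case True
  define F where "F t = \<omega> (clamp01 t)" for t
  have F: "abs_cont F" unfolding F_def by (rule abs_cont_clamp[OF True])
  obtain g where g: "integrable lborel g" "\<And>u v. u \<le> v \<Longrightarrow> F v - F u = (LBINT t:{u..v}. g t)"
    using abs_cont_path_eq_integral[OF F] unfolding F_def by auto
  have [measurable]: "g \<in> borel_measurable borel" using g by auto
  have deriv: "AE x in lborel. (F has_real_derivative g x) (at x)"
    by (rule indefinite_integral_has_derivative_AE[OF g abs_cont_continuous[OF F]])
  have dw: "deriv \<omega> x = g x" if "(F has_real_derivative g x) (at x)" "0 < x" "x < 1" for x
  proof -
    have "(\<omega> has_real_derivative g x) (at x)"
      by (rule has_field_derivative_transform_within_open[OF that(1), of "{0<..<1}"])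
        (use that in \<open>auto simp: F_def\<close>)
    then show ?thesis by (rule DERIV_imp_deriv)
  qed
  define c where "c = F 1 - F 0"
  have "AE x in lborel. x \<noteq> (0::real)" by (rule AE_lborel_singleton)
  moreover have "AE x in lborel. x \<noteq> (1::real)" by (rule AE_lborel_singleton)
  moreover note deriv
  ultimately have "AE x in lborel. ennreal (1/2 * \<bar>deriv \<omega> x\<bar>\<^sup>2) * indicator {0..1} x = ennreal (1/2 * (g x)\<^sup>2) * indicator {0..1} x"
  proof eventually_elim
    case (elim x)
    show ?case
    proof (cases "0 < x \<and> x < 1")
      case True
      then show ?thesis using dw[OF elim(3)] by simp
    next
      case False
      then have "x \<notin> {0..1}" using elim(1,2) by auto
      then show ?thesis by simp
    qed
  qed
  then have pa: "path_action \<omega> = (\<integral>\<^sup>+x\<in>{0..1}. ennreal (1/2 * (g x)\<^sup>2) \<partial>lborel)"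
    using True unfolding path_action_def by (simp add: nn_integral_cong_AE)
  have int: "set_integrable lborel {0..1} g"
    unfolding set_integrable_def by (intro integrable_mult_indicator g) auto
  have int_c: "set_integrable lborel {0..1::real} (\<lambda>x. k)" for k :: real
    by (rule borel_integrable_atLeastAtMost') simp
  have int2: "set_integrable lborel {0..1} (\<lambda>x. c * g x - c\<^sup>2 / 2)"
    by (intro set_integral_diff int_c set_integrable_mult_right int)
  \<comment> \<open>As \<open>y\<^sup>2/2 \<ge> c * y - c\<^sup>2/2\<close> with equality at \<open>y = c\<close>, the total displacement \<open>c\<close> is the best choice
    of the slope, and the bound is linear in \<open>g\<close>.\<close>
  have "(LBINT x:{0..1}. c * g x - c\<^sup>2 / 2) = (LBINT x:{0..1}. c * g x) - (LBINT x:{0..1::real}. c\<^sup>2 / 2)"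
    by (intro set_integral_diff(2) int_c set_integrable_mult_right int)
  also have "(LBINT x:{0..1}. c * g x) = c * c"
    using g(2)[of 0 1] by (simp add: c_def)
  also have "(LBINT x:{0..1::real}. c\<^sup>2 / 2) = c\<^sup>2 / 2"
    by (simp add: set_lebesgue_integral_def)
  finally have val: "(LBINT x:{0..1}. c * g x - c\<^sup>2 / 2) = 1/2 * c\<^sup>2"
    by (simp add: power2_eq_square)
  have "ennreal (1/2 * c\<^sup>2) = ennreal (LBINT x:{0..1}. c * g x - c\<^sup>2 / 2)" by (simp only: val)
  also have "\<dots> \<le> (\<integral>\<^sup>+x. ennreal (indicator {0..1} x * (c * g x - c\<^sup>2 / 2)) \<partial>lborel)"
    unfolding set_lebesgue_integral_def real_scaleR_def
    using int2 unfolding set_integrable_def real_scaleR_def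
    by (rule ennreal_integral_le_nn_integral)
  also have "\<dots> \<le> (\<integral>\<^sup>+x\<in>{0..1}. ennreal (1/2 * (g x)\<^sup>2) \<partial>lborel)"
  proof (intro nn_integral_mono)
    fix x
    have "0 \<le> (g x - c)\<^sup>2" by simp
    then have "c * g x - c\<^sup>2 / 2 \<le> 1/2 * (g x)\<^sup>2" by (simp add: power2_diff field_simps)
    then show "ennreal (indicator {0..1} x * (c * g x - c\<^sup>2 / 2)) \<le> ennreal (1/2 * (g x)\<^sup>2) * indicator {0..1} x"
      by (auto simp: indicator_def intro!: ennreal_leI)
  qed
  finally show ?thesis by (simp add: pa c_def F_def)
qed (simp add: path_action_def)

section \<open>Cutting the unit interval into cells\<close>

lemma bounded_borel_set_integrable:
  fixes f :: "real \<Rightarrow> real"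
  assumes "f \<in> borel_measurable borel" "\<And>x. \<bar>f x\<bar> \<le> B" "A \<in> sets borel" "A \<subseteq> {a..b}"
  shows "set_integrable lborel A f"
proof -
  have "set_integrable lborel {a..b} (\<lambda>_. B)"
    by (rule borel_integrable_atLeastAtMost') simp
  then have "set_integrable lborel A (\<lambda>_. B)"
    by (rule set_integrable_subset) (use assms in auto)
  then show ?thesis
    by (rule set_integrable_bound)
      (use assms(1,3) order_trans[OF assms(2) abs_ge_self] in \<open>auto simp: set_borel_measurable_def\<close>)
qed

lemma set_integral_affine:
  fixes f :: "real \<Rightarrow> real"
  assumes "c > 0"
  shows "(LBINT y:{t + c * a<..t + c * b}. f y) = c * (LBINT x:{a<..b}. f (t + c * x))"
proof -
  have "(LBINT y:{t + c * a<..t + c * b}. f y)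
      = c * (\<integral>x. indicator {t + c * a<..t + c * b} (t + c * x) * f (t + c * x) \<partial>lborel)"
    unfolding set_lebesgue_integral_def
    using lborel_integral_real_affine[of c "\<lambda>y. indicator {t + c * a<..t + c * b} y * f y" t] assms by simp
  also have "(\<lambda>x. indicator {t + c * a<..t + c * b} (t + c * x) * f (t + c * x)) = (\<lambda>x. indicator {a<..b} x * f (t + c * x))"
    using assms by (auto simp: indicator_def fun_eq_iff)
  finally show ?thesis by (simp add: set_lebesgue_integral_def)
qed

lemma set_integral_Ioc_eq_Icc:
  fixes f :: "real \<Rightarrow> real"
  assumes "f \<in> borel_measurable borel"
  shows "(LBINT x:{a<..b}. f x) = (LBINT x:{a..b}. f x)"
proof (rule set_integral_cong_set)
  show "AE x in lborel. (x \<in> {a..b}) = (x \<in> {a<..b})"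
    using AE_lborel_singleton[of a] by eventually_elim auto
qed (use assms in \<open>auto simp: set_borel_measurable_def\<close>)

lemma integral_unit_interval_cells:
  fixes f :: "real \<Rightarrow> real"
  assumes f[measurable]: "f \<in> borel_measurable borel" and B: "\<And>x. \<bar>f x\<bar> \<le> B" and m: "m > 0"
  shows "(LBINT y:{0..1}. f y) = (\<Sum>k<m. LBINT x:{0..1 / real m}. f (real k / real m + x))"
proof -
  have "(LBINT y:{0<..real j / real m}. f y) = (\<Sum>k<j. LBINT x:{0..1 / real m}. f (real k / real m + x))" for j
  proof (induction j)
    case (Suc j)
    have cell: "(LBINT y:{real j / real m<..real (Suc j) / real m}. f y) = (LBINT x:{0..1 / real m}. f (real j / real m + x))"
      using set_integral_affine[of 1 "real j / real m" 0 "1 / real m" f]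
      by (simp add: add_divide_distrib add.commute set_integral_Ioc_eq_Icc)
    have "{0<..real (Suc j) / real m} = {0<..real j / real m} \<union> {real j / real m<..real (Suc j) / real m}"
      using m by (intro ivl_disj_un_two(6)[symmetric]) (auto simp: divide_right_mono)
    then have "(LBINT y:{0<..real (Suc j) / real m}. f y)
        = (LBINT y:{0<..real j / real m}. f y) + (LBINT y:{real j / real m<..real (Suc j) / real m}. f y)"
      by (simp only:) (intro set_integral_Un bounded_borel_set_integrable[OF f B, of _ 0 "real (Suc j) / real m"]
           bounded_borel_set_integrable[OF f B, of _ "real j / real m" "real (Suc j) / real m"], auto intro: order_trans simp: divide_right_mono)
    then show ?case using Suc.IH cell by simp
  qed (simp add: set_lebesgue_integral_def)
  from this[of m] show ?thesis using m by (simp add: set_integral_Ioc_eq_Icc)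
qed

text \<open>
  The doubling map of the unit interval. Under \<open>mu_inf\<close> it recovers the mark from the position; its
  value at \<open>1\<close> is \<open>1\<close>, so that it maps \<open>D\<close> to itself.
\<close>

definition doubling :: "real \<Rightarrow> real" where
  "doubling y = (if y < 1/2 then 2 * y else 2 * y - 1)"

text \<open>
  The map that recovers the mark from the position under \<open>mu n\<close>: with \<open>0 \<le> x < 1/(2n)\<close> it sends the point
  \<open>i/(2n) + x\<close> of the lower half to \<open>i/n + x\<close>, and the point \<open>1/2 + i/(2n) + x\<close> of the upper half to
  \<open>(2i+1)/(2n) + x\<close>. For \<open>n \<ge> 1\<close> the truncation by \<open>1\<close> takes effect only at the point \<open>1\<close>, where the
  formula would leave \<open>D\<close>.
\<close>

definition cell_map :: "nat \<Rightarrow> real \<Rightarrow> real" where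
  "cell_map n y = min 1 (if y < 1/2 then y + of_int \<lfloor>2 * real n * y\<rfloor> / (2 * real n)
     else y - 1/2 + (of_int \<lfloor>2 * real n * (y - 1/2)\<rfloor> + 1) / (2 * real n))"

lemma doubling_measurable [measurable]: "doubling \<in> borel_measurable borel"
  and cell_map_measurable [measurable]: "cell_map n \<in> borel_measurable borel"
  unfolding doubling_def cell_map_def by measurable

lemma doubling_in_D: "y \<in> D \<Longrightarrow> doubling y \<in> D"
  by (auto simp: doubling_def D_def)

lemma cell_map_in_D: "y \<in> D \<Longrightarrow> cell_map n y \<in> D"
proof -
  assume y: "y \<in> D"
  have "0 \<le> y + of_int \<lfloor>2 * real n * y\<rfloor> / (2 * real n)"
    using y by (auto simp: D_def intro!: add_nonneg_nonneg divide_nonneg_nonneg)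
  moreover have "0 \<le> y - 1/2 + (of_int \<lfloor>2 * real n * (y - 1/2)\<rfloor> + 1) / (2 * real n)" if "\<not> y < 1/2"
    using that by (auto intro!: add_nonneg_nonneg divide_nonneg_nonneg)
  ultimately show ?thesis by (auto simp: cell_map_def D_def)
qed

lemma cell_map_lower_half:
  assumes n: "n > 0" and i: "i < n" and x: "0 \<le> x" "x < 1 / (2 * real n)"
  shows "cell_map n (real i / (2 * real n) + x) = real i / real n + x"
proof -
  define y where "y = real i / (2 * real n) + x"
  have i1: "real i + 1 \<le> real n" using i by linarith
  have "x * (2 * real n) < 1" using x n by (simp add: field_simps)
  then have fl: "\<lfloor>2 * real n * y\<rfloor> = int i"
    using n x by (intro floor_unique) (auto simp: y_def field_simps)
  have "y < (real i + 1) / (2 * real n)" using x by (simp add: y_def add_divide_distrib)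
  also have "\<dots> \<le> 1/2" using i1 n by (simp add: field_simps)
  finally have half: "y < 1/2" .
  have "real i / real n + x < 1"
  proof -
    have "real i / real n + x \<le> 2 * y" using x n by (simp add: y_def field_simps)
    then show ?thesis using half by simp
  qed
  moreover have "y + real i / (2 * real n) = real i / real n + x" using n by (simp add: y_def field_simps)
  ultimately show ?thesis
    unfolding y_def[symmetric] using half fl by (simp add: cell_map_def)
qed

lemma cell_map_upper_half:
  assumes n: "n > 0" and i: "i < n" and x: "0 \<le> x" "x < 1 / (2 * real n)"
  shows "cell_map n (1/2 + real i / (2 * real n) + x) = (2 * real i + 1) / (2 * real n) + x"
proof -
  define y where "y = 1/2 + real i / (2 * real n) + x"
  have i1: "real i + 1 \<le> real n" using i by linarith
  have xn: "x * (2 * real n) < 1" using x n by (simp add: field_simps)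
  then have fl: "\<lfloor>2 * real n * (y - 1/2)\<rfloor> = int i"
    using n x by (intro floor_unique) (auto simp: y_def field_simps)
  have "0 \<le> real i / (2 * real n)" by simp
  then have half: "\<not> y < 1/2" unfolding y_def using x by linarith
  have "(2 * real i + 1) / (2 * real n) + x \<le> (2 * real i + 2) / (2 * real n)"
    using x by (simp add: add_divide_distrib)
  also have "\<dots> \<le> 1" using i1 n by (simp add: field_simps)
  finally have "(2 * real i + 1) / (2 * real n) + x \<le> 1" .
  moreover have "y - 1/2 + (real i + 1) / (2 * real n) = (2 * real i + 1) / (2 * real n) + x"
    using n by (simp add: y_def field_simps)
  ultimately show ?thesis
    unfolding y_def[symmetric] using half fl by (simp add: cell_map_def)
qed

lemma integral_over_doubling:
  fixes f :: "real \<times> real \<Rightarrow> real"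
  assumes f[measurable]: "f \<in> borel_measurable borel" and B: "\<And>p. \<bar>f p\<bar> \<le> B"
  shows "(LBINT y:{0..1}. f (doubling y, y)) = 1/2 * (LBINT x:{0..1}. f (x, x/2) + f (x, 1/2 + x/2))"
proof -
  have fb: "f \<in> borel_measurable (borel \<Otimes>\<^sub>M borel)" by (simp add: borel_prod)
  note [measurable] = fb
  have "(LBINT y:{0..1}. f (doubling y, y)) = (\<Sum>k<2. LBINT x:{0..1 / real 2}. f (doubling (real k / real 2 + x), real k / real 2 + x))"
    by (rule integral_unit_interval_cells[of "\<lambda>y. f (doubling y, y)" B 2]) (auto simp: B)
  also have "\<dots> = (LBINT x:{0..1/2}. f (doubling x, x)) + (LBINT x:{0..1/2}. f (doubling (1/2 + x), 1/2 + x))"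
    by (simp add: numeral_2_eq_2)
  also have "(LBINT x:{0..1/2}. f (doubling x, x)) = (LBINT x:{0..1/2}. f (2 * x, x))"
  proof (rule set_lebesgue_integral_cong_AE)
    show "AE x\<in>{0..1/2} in lborel. f (doubling x, x) = f (2 * x, x)"
      using AE_lborel_singleton[of "1/2::real"] by eventually_elim (auto simp: doubling_def)
  qed auto
  also have "(LBINT x:{0..1/2}. f (doubling (1/2 + x), 1/2 + x)) = (LBINT x:{0..1/2}. f (2 * x, 1/2 + x))"
    by (rule set_lebesgue_integral_cong) (auto simp: doubling_def)
  also have "(LBINT x:{0..1/2}. f (2 * x, x)) = 1/2 * (LBINT x:{0..1}. f (x, x/2))"
    using set_integral_affine[of "1/2" 0 0 1 "\<lambda>x. f (2 * x, x)"] by (simp add: set_integral_Ioc_eq_Icc)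
  also have "(LBINT x:{0..1/2}. f (2 * x, 1/2 + x)) = 1/2 * (LBINT x:{0..1}. f (x, 1/2 + x/2))"
    using set_integral_affine[of "1/2" 0 0 1 "\<lambda>x. f (2 * x, 1/2 + x)"] by (simp add: set_integral_Ioc_eq_Icc)
  also have "1/2 * (LBINT x:{0..1}. f (x, x/2)) + 1/2 * (LBINT x:{0..1}. f (x, 1/2 + x/2))
      = 1/2 * (LBINT x:{0..1}. f (x, x/2) + f (x, 1/2 + x/2))"
    by (subst set_integral_add(2)) (auto simp: B intro!: bounded_borel_set_integrable[where B=B and a=0 and b=1])
  finally show ?thesis .
qed

lemma sum_lessThan_double_halves:
  fixes g :: "nat \<Rightarrow> real"
  shows "(\<Sum>k<2 * n. g k) = (\<Sum>i<n. g i + g (n + i))"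
proof -
  have "(\<Sum>k<n + m. g k) = (\<Sum>i<n. g i) + (\<Sum>i<m. g (n + i))" for m
    by (induction m) auto
  from this[of n] show ?thesis by (simp add: mult_2 sum.distrib)
qed

lemma sum_lessThan_double_parity:
  fixes g :: "nat \<Rightarrow> real"
  shows "(\<Sum>k<2 * n. g k) = (\<Sum>i<n. g (2 * i) + g (2 * i + 1))"
  by (induction n) auto

lemma integral_over_cell_map:
  fixes f :: "real \<times> real \<Rightarrow> real"
  assumes f[measurable]: "f \<in> borel_measurable borel" and B: "\<And>p. \<bar>f p\<bar> \<le> B" and n: "n > 0"
  shows "(LBINT y:{0..1}. f (cell_map n y, y)) = (\<Sum>i<n. LBINT x:{0..1 / (2 * real n)}.
       f (real i / real n + x, real i / (2 * real n) + x) +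
       f ((2 * real i + 1) / (2 * real n) + x, 1/2 + real i / (2 * real n) + x))"
proof -
  have fb: "f \<in> borel_measurable (borel \<Otimes>\<^sub>M borel)" by (simp add: borel_prod)
  note [measurable] = fb
  let ?h = "\<lambda>k::nat. LBINT x:{0..1 / (2 * real n)}. f (cell_map n (real k / (2 * real n) + x), real k / (2 * real n) + x)"
  have "(LBINT y:{0..1}. f (cell_map n y, y)) = (\<Sum>k<2 * n. ?h k)"
    using integral_unit_interval_cells[of "\<lambda>y. f (cell_map n y, y)" B "2 * n"] B n by simp
  also have "\<dots> = (\<Sum>i<n. ?h i + ?h (n + i))"
    by (rule sum_lessThan_double_halves)
  also have "\<dots> = (\<Sum>i<n. LBINT x:{0..1 / (2 * real n)}.
       f (real i / real n + x, real i / (2 * real n) + x) +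
       f ((2 * real i + 1) / (2 * real n) + x, 1/2 + real i / (2 * real n) + x))"
  proof (rule sum.cong)
    fix i assume "i \<in> {..<n}"
    then have i: "i < n" by simp
    have "?h i = (LBINT x:{0..1 / (2 * real n)}. f (real i / real n + x, real i / (2 * real n) + x))"
    proof (rule set_lebesgue_integral_cong_AE)
      show "AE x\<in>{0..1 / (2 * real n)} in lborel. f (cell_map n (real i / (2 * real n) + x), real i / (2 * real n) + x)
          = f (real i / real n + x, real i / (2 * real n) + x)"
        using AE_lborel_singleton[of "1 / (2 * real n)"] by eventually_elim (simp add: cell_map_lower_half[OF n i])
    qed auto
    moreover have "?h (n + i) = (LBINT x:{0..1 / (2 * real n)}. f ((2 * real i + 1) / (2 * real n) + x, 1/2 + real i / (2 * real n) + x))"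
    proof (rule set_lebesgue_integral_cong_AE)
      have e: "real (n + i) / (2 * real n) = 1/2 + real i / (2 * real n)"
        using n by (simp add: field_simps)
      show "AE x\<in>{0..1 / (2 * real n)} in lborel. f (cell_map n (real (n + i) / (2 * real n) + x), real (n + i) / (2 * real n) + x)
          = f ((2 * real i + 1) / (2 * real n) + x, 1/2 + real i / (2 * real n) + x)"
        unfolding e using AE_lborel_singleton[of "1 / (2 * real n)"] by eventually_elim (simp add: cell_map_upper_half[OF n i])
    qed auto
    ultimately show "?h i + ?h (n + i) = (LBINT x:{0..1 / (2 * real n)}.
       f (real i / real n + x, real i / (2 * real n) + x) +
       f ((2 * real i + 1) / (2 * real n) + x, 1/2 + real i / (2 * real n) + x))"
      by (subst set_integral_add(2)) (auto simp: B intro!: bounded_borel_set_integrable[where B=B and a=0 and b="1 / (2 * real n)"])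
  qed simp
  finally show ?thesis .
qed

section \<open>Measures on the square and their integrals\<close>

lemma space_lebesgue_D [simp]: "space lebesgue_D = D"
  by (simp add: lebesgue_D_def space_restrict_space)

lemma sets_lebesgue_D: "sets lebesgue_D = sets (restrict_space borel D)"
  by (simp add: lebesgue_D_def sets_restrict_space)

lemma D_borel [measurable, simp]: "D \<in> sets borel"
  by (simp add: D_def)

lemma space_borel_square [simp]: "space borel_square = D \<times> D"
  by (simp add: borel_square_def space_restrict_space)

lemma DD_borel [measurable, simp]: "D \<times> D \<in> sets borel"
  by (simp add: D_def closed_Times)

lemma emeasure_lebesgue_D: "A \<in> sets borel \<Longrightarrow> A \<subseteq> D \<Longrightarrow> emeasure lebesgue_D A = emeasure lborel A"
  by (simp add: lebesgue_D_def emeasure_restrict_space)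

lemma prob_lebesgue_D: "emeasure lebesgue_D D = 1"
  by (subst emeasure_lebesgue_D) (auto simp: D_def)

lemma lebesgue_D_integral:
  fixes f :: "real \<Rightarrow> real"
  shows "integral\<^sup>L lebesgue_D f = (LBINT y:{0..1}. f y)"
  unfolding lebesgue_D_def set_lebesgue_integral_def D_def by (subst integral_restrict_space) auto

text \<open>
  Invariance of Lebesgue measure on \<open>D\<close> under \<open>T\<close>, tested on bounded Borel functions.
\<close>

lemma distr_lebesgue_D_eqI:
  assumes T[measurable]: "T \<in> borel_measurable borel" and TD: "T \<in> D \<rightarrow> D"
    and inv: "\<And>h :: real \<Rightarrow> real. h \<in> borel_measurable borel \<Longrightarrow> (\<And>x. \<bar>h x\<bar> \<le> 1) \<Longrightarrow>
      (LBINT y:{0..1}. h (T y)) = (LBINT y:{0..1}. h y)"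
  shows "distr lebesgue_D lebesgue_D T = lebesgue_D"
proof (rule measure_eqI)
  have Tm: "T \<in> measurable lebesgue_D lebesgue_D"
    unfolding lebesgue_D_def using TD
    by (intro measurable_restrict_space3) (auto simp: )
  fix A assume "A \<in> sets (distr lebesgue_D lebesgue_D T)"
  then have "A \<in> sets lebesgue_D" by simp
  then have A[measurable]: "A \<in> sets borel" "A \<subseteq> D"
    by (auto simp: sets_lebesgue_D sets_restrict_space_iff)
  have Bo: "T -` A \<inter> D \<in> sets borel"
  proof -
    have "T -` A \<inter> space borel \<in> sets borel" by (rule measurable_sets[OF T A(1)])
    then show ?thesis by auto
  qed
  have fin: "emeasure lborel X < \<infinity>" if "X \<subseteq> D" for X
  proof -
    have "emeasure lborel X \<le> emeasure lborel {0..1::real}"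
      using that by (intro emeasure_mono) (auto simp: D_def)
    also have "\<dots> < \<infinity>" by simp
    finally show ?thesis .
  qed
  have "emeasure (distr lebesgue_D lebesgue_D T) A = emeasure lborel (T -` A \<inter> D)"
    using Tm \<open>A \<in> sets lebesgue_D\<close> Bo by (simp add: emeasure_distr emeasure_lebesgue_D)
  also have "\<dots> = ennreal (measure lborel (T -` A \<inter> D))"
    using fin[of "T -` A \<inter> D"] by (intro emeasure_eq_ennreal_measure) auto
  also have "measure lborel (T -` A \<inter> D) = (LBINT y:{0..1}. indicator A (T y))"
  proof -
    have "(LBINT y:{0..1}. indicator A (T y)) = integral\<^sup>L lborel (indicator (T -` A \<inter> D) :: real \<Rightarrow> real)"
      unfolding set_lebesgue_integral_def by (intro Bochner_Integration.integral_cong) (auto simp: indicator_def D_def)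
    then show ?thesis using Bo by simp
  qed
  also have "\<dots> = (LBINT y:{0..1}. indicator A y)"
    by (rule inv) (auto simp: indicator_def)
  also have "\<dots> = measure lborel A"
  proof -
    have "(LBINT y:{0..1}. indicator A y) = integral\<^sup>L lborel (indicator A :: real \<Rightarrow> real)"
      unfolding set_lebesgue_integral_def using A(2)
      by (intro Bochner_Integration.integral_cong) (auto simp: indicator_def D_def)
    then show ?thesis by simp
  qed
  also have "ennreal (measure lborel A) = emeasure lborel A"
    using fin[OF A(2)] by (intro emeasure_eq_ennreal_measure[symmetric]) auto
  also have "\<dots> = emeasure lebesgue_D A"
    using A by (simp add: emeasure_lebesgue_D)
  finally show "emeasure (distr lebesgue_D lebesgue_D T) A = emeasure lebesgue_D A" .
qed simp

text \<open>
  The measure of a closed set \<open>C\<close> is the limit of the integrals of the continuous functions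
  \<open>max 0 (1 - k * infdist x C)\<close>, which decrease to the indicator of \<open>C\<close>; closed sets are stable under
  intersection and generate the Borel sets. Passing to the image measures on the whole plane avoids
  working with the relative topology of the square.
\<close>

lemma measure_eq_of_continuous_integrals:
  assumes sM: "sets M = sets borel_square" and sN: "sets N = sets borel_square"
    and M: "\<And>\<alpha> :: real \<times> real \<Rightarrow> real. continuous_on (D \<times> D) \<alpha> \<Longrightarrow> integrable M \<alpha> \<and> integral\<^sup>L M \<alpha> = L \<alpha>"
    and N: "\<And>\<alpha> :: real \<times> real \<Rightarrow> real. continuous_on (D \<times> D) \<alpha> \<Longrightarrow> integrable N \<alpha> \<and> integral\<^sup>L N \<alpha> = L \<alpha>"
  shows "M = N"
proof -
  have spM: "space M = D \<times> D" "space N = D \<times> D"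
    using sets_eq_imp_space_eq[OF sM] sets_eq_imp_space_eq[OF sN] by simp_all
  have fin: "emeasure K (D \<times> D) < \<infinity>" if "space K = D \<times> D" "integrable K (\<lambda>_. 1 :: real)" for K :: "(real \<times> real) measure"
  proof -
    have "integrable K (indicator (D \<times> D) :: _ \<Rightarrow> real)"
      using that by (subst Bochner_Integration.integrable_cong[of K K _ "\<lambda>_. 1"]) auto
    then show ?thesis using that by (simp add: integrable_indicator_iff)
  qed
  have finM: "emeasure M (D \<times> D) < \<infinity>" and finN: "emeasure N (D \<times> D) < \<infinity>"
    using fin[OF spM(1)] fin[OF spM(2)] M[of "\<lambda>_. 1"] N[of "\<lambda>_. 1"] by auto
  have closed_eq: "measure K (C \<inter> (D \<times> D)) = lim (\<lambda>k. L (\<lambda>x. max 0 (1 - real k * infdist x C)))"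
    if K: "sets K = sets borel_square"
      "\<And>\<alpha> :: real \<times> real \<Rightarrow> real. continuous_on (D \<times> D) \<alpha> \<Longrightarrow> integrable K \<alpha> \<and> integral\<^sup>L K \<alpha> = L \<alpha>"
      and C: "closed C" "C \<noteq> {}" for K and C :: "(real \<times> real) set"
  proof -
    have spK: "space K = D \<times> D" using sets_eq_imp_space_eq[OF K(1)] by simp
    have cont: "continuous_on (D \<times> D) (\<lambda>x. max 0 (1 - real k * infdist x C))" for k
      by (intro continuous_intros)
    have "(\<lambda>k. integral\<^sup>L K (\<lambda>x. max 0 (1 - real k * infdist x C))) \<longlonglongrightarrow> integral\<^sup>L K (indicator C)"
    proof (rule integral_dominated_convergence[where w="\<lambda>_. 1"])
      have "C \<inter> (D \<times> D) \<in> sets K"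
        using C K by (auto simp: borel_square_def sets_restrict_space_iff)
      then show "(indicator C :: _ \<Rightarrow> real) \<in> borel_measurable K"
        by (subst borel_measurable_indicator_iff) (simp add: spK)
      show "(\<lambda>x. max 0 (1 - real k * infdist x C)) \<in> borel_measurable K" for k
        using K(2)[OF cont[of k]] by auto
      show "integrable K (\<lambda>_. 1 :: real)" using K(2)[of "\<lambda>_. 1"] by auto
      show "AE x in K. norm (max 0 (1 - real k * infdist x C)) \<le> 1" for k
        by (auto simp: infdist_nonneg)
      show "AE x in K. (\<lambda>k. max 0 (1 - real k * infdist x C)) \<longlonglongrightarrow> indicator C x"
      proof (rule AE_I2)
        fix x
        show "(\<lambda>k. max 0 (1 - real k * infdist x C)) \<longlonglongrightarrow> indicator C x"
        proof (cases "x \<in> C")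
          case True
          then show ?thesis by simp
        next
          case False
          then have pos: "infdist x C > 0"
            using C in_closed_iff_infdist_zero[of C x] infdist_nonneg[of x C] by (auto simp: less_le)
          obtain K0 where K0: "1 / infdist x C < real K0" using reals_Archimedean2 by blast
          have "\<forall>\<^sub>F k in sequentially. max 0 (1 - real k * infdist x C) = indicator C x"
            using eventually_ge_at_top[of K0]
          proof eventually_elim
            case (elim k)
            then have "1 / infdist x C < real k" using K0 by simp
            then have "1 < real k * infdist x C" using pos by (simp add: divide_less_eq)
            then show ?case using False by simp
          qed
          then show ?thesis by (rule tendsto_eventually)
        qed
      qed
    qed
    then have "lim (\<lambda>k. L (\<lambda>x. max 0 (1 - real k * infdist x C))) = integral\<^sup>L K (indicator C)"
      using K(2)[OF cont] by (simp add: limI)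
    also have "\<dots> = measure K (C \<inter> (D \<times> D))"
      by (simp add: spK)
    finally show ?thesis by simp
  qed
  have idM: "(\<lambda>x. x) \<in> measurable M borel" "(\<lambda>x. x) \<in> measurable N borel"
    using sM sN by (auto simp: measurable_cong_sets[OF sM refl] measurable_cong_sets[OF sN refl] borel_square_def intro: measurable_restrict_space1)
  have "distr M borel (\<lambda>x. x) = distr N borel (\<lambda>x. x)"
  proof (rule measure_eqI_generator_eq[where E="Collect closed" and A="\<lambda>_. UNIV" and \<Omega>=UNIV])
    show "Int_stable (Collect (closed :: (real \<times> real) set \<Rightarrow> bool))"
      by (auto simp: Int_stable_def)
    show "sets (distr M borel (\<lambda>x. x)) = sigma_sets UNIV (Collect closed)"
      "sets (distr N borel (\<lambda>x. x)) = sigma_sets UNIV (Collect closed)"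
      by (simp_all add: borel_eq_closed)
    show "emeasure (distr M borel (\<lambda>x. x)) UNIV \<noteq> \<infinity>"
      using idM spM finM by (simp add: emeasure_distr)
    fix C :: "(real \<times> real) set" assume "C \<in> Collect closed"
    then have C: "closed C" by simp
    have em: "emeasure (distr K borel (\<lambda>x. x)) C = ennreal (measure K (C \<inter> (D \<times> D)))"
      if "(\<lambda>x. x) \<in> measurable K borel" "space K = D \<times> D" "emeasure K (D \<times> D) < \<infinity>" for K
    proof -
      interpret finite_measure K using that by (intro finite_measureI) auto
      show ?thesis using that C by (simp add: emeasure_distr emeasure_eq_measure)
    qed
    show "emeasure (distr M borel (\<lambda>x. x)) C = emeasure (distr N borel (\<lambda>x. x)) C"
      unfolding em[OF idM(1) spM(1) finM] em[OF idM(2) spM(2) finN]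
      using closed_eq[OF sM M C] closed_eq[OF sN N C] by (cases "C = {}") auto
  qed auto
  then have eq: "emeasure (distr M borel (\<lambda>x. x)) A = emeasure (distr N borel (\<lambda>x. x)) A" for A by simp
  show ?thesis
  proof (rule measure_eqI)
    fix A assume "A \<in> sets M"
    then have A: "A \<in> sets borel" "A \<inter> (D \<times> D) = A"
      using sM by (auto simp: borel_square_def sets_restrict_space_iff)
    show "emeasure M A = emeasure N A"
      using eq[of A] A idM spM by (simp add: emeasure_distr)
  qed (simp add: sM sN)
qed

lemma measure_with_integrals_eq:
  assumes "sets M = sets borel_square"
    and "\<And>\<alpha> :: real \<times> real \<Rightarrow> real. continuous_on (D \<times> D) \<alpha> \<Longrightarrow> integrable M \<alpha> \<and> integral\<^sup>L M \<alpha> = L \<alpha>"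
  shows "measure_with_integrals L = M"
  unfolding measure_with_integrals_def
proof (rule the_equality)
  fix N assume N: "sets N = sets borel_square \<and> (\<forall>\<alpha>. continuous_on (D \<times> D) \<alpha> \<longrightarrow> integrable N \<alpha> \<and> integral\<^sup>L N \<alpha> = L \<alpha>)"
  then show "N = M"
    using assms by (intro measure_eq_of_continuous_integrals[of N M L]) auto
qed (use assms in auto)

section \<open>The measures as images of Lebesgue measure\<close>

text \<open>
  The law of \<open>(T y, y)\<close> for \<open>y\<close> uniform in \<open>D\<close>. The second marginal is uniform for every \<open>T\<close>; the first one
  is when \<open>T\<close> preserves Lebesgue measure.
\<close>

definition graph_measure :: "(real \<Rightarrow> real) \<Rightarrow> (real \<times> real) measure" where
  "graph_measure T = distr lebesgue_D borel_square (\<lambda>y. (T y, y))"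

lemma sets_graph_measure [simp]: "sets (graph_measure T) = sets borel_square"
  by (simp add: graph_measure_def)

lemma doubling_Pi_D: "doubling \<in> D \<rightarrow> D" and cell_map_Pi_D: "cell_map n \<in> D \<rightarrow> D"
  using doubling_in_D cell_map_in_D by auto

lemma graph_measurable:
  assumes [measurable]: "T \<in> borel_measurable borel" and TD: "T \<in> D \<rightarrow> D"
  shows "(\<lambda>y. (T y, y)) \<in> measurable lebesgue_D borel_square"
proof -
  have "(\<lambda>y. (T y, y)) \<in> measurable borel (borel :: (real \<times> real) measure)"
    unfolding borel_prod[symmetric] by measurable
  then have "(\<lambda>y. (T y, y)) \<in> measurable (restrict_space borel D) borel_square"
    unfolding borel_square_def using TD by (intro measurable_restrict_space3) auto
  then show ?thesis
    by (simp add: measurable_cong_sets[OF sets_lebesgue_D refl])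
qed

lemma borel_square_proj: "fst \<in> measurable borel_square lebesgue_D" "snd \<in> measurable borel_square lebesgue_D"
proof -
  have "fst \<in> measurable borel_square (restrict_space borel D)" "snd \<in> measurable borel_square (restrict_space borel D)"
    unfolding borel_square_def
    by (intro measurable_restrict_space3; auto simp: borel_prod[symmetric])+
  then show "fst \<in> measurable borel_square lebesgue_D" "snd \<in> measurable borel_square lebesgue_D"
    by (simp_all add: measurable_cong_sets[OF refl sets_lebesgue_D])
qed

lemma bistochastic_graph_measure:
  assumes T: "T \<in> borel_measurable borel" and TD: "T \<in> D \<rightarrow> D"
    and inv: "\<And>h :: real \<Rightarrow> real. h \<in> borel_measurable borel \<Longrightarrow> (\<And>x. \<bar>h x\<bar> \<le> 1) \<Longrightarrow>
      (LBINT y:{0..1}. h (T y)) = (LBINT y:{0..1}. h y)"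
  shows "bistochastic (graph_measure T)"
proof -
  note g = graph_measurable[OF T TD]
  have "distr (graph_measure T) lebesgue_D fst = distr lebesgue_D lebesgue_D T"
    unfolding graph_measure_def distr_distr[OF borel_square_proj(1) g] by (simp add: comp_def)
  also have "\<dots> = lebesgue_D"
  proof (rule distr_lebesgue_D_eqI[OF T TD])
    show "(LBINT y:{0..1}. h (T y)) = (LBINT y:{0..1}. h y)"
      if "h \<in> borel_measurable borel" "\<And>x. \<bar>h x\<bar> \<le> 1" for h :: "real \<Rightarrow> real"
      by (rule inv[OF that])
  qed
  finally have 1: "distr (graph_measure T) lebesgue_D fst = lebesgue_D" .
  have "distr (graph_measure T) lebesgue_D snd = distr lebesgue_D lebesgue_D (\<lambda>y. y)"
    unfolding graph_measure_def distr_distr[OF borel_square_proj(2) g] by (simp add: comp_def)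
  also have "\<dots> = lebesgue_D" by (rule distr_id2) simp
  finally show ?thesis using 1 by (simp add: bistochastic_def)
qed

lemma graph_measure_integral_borel:
  fixes f :: "real \<times> real \<Rightarrow> real"
  assumes T: "T \<in> borel_measurable borel" and TD: "T \<in> D \<rightarrow> D"
    and f: "f \<in> borel_measurable borel" and B: "\<And>p. \<bar>f p\<bar> \<le> B"
  shows "integrable (graph_measure T) f \<and> integral\<^sup>L (graph_measure T) f = (LBINT y:{0..1}. f (T y, y))"
proof -
  note g = graph_measurable[OF T TD]
  have fm: "f \<in> borel_measurable borel_square"
    unfolding borel_square_def using f by (rule measurable_restrict_space1)
  have "emeasure (graph_measure T) (space (graph_measure T)) = 1"
  proof -
    have "(\<lambda>y. (T y, y)) -` (D \<times> D) \<inter> D = D" using TD by auto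
    then show ?thesis
      using emeasure_distr[OF g, of "D \<times> D"] sets.top[of borel_square] prob_lebesgue_D
      by (simp add: graph_measure_def)
  qed
  then interpret finite_measure "graph_measure T" by (intro finite_measureI) simp
  have "integrable (graph_measure T) f"
    by (rule integrable_const_bound[where B=B]) (use B fm in \<open>auto simp: measurable_cong_sets[OF sets_graph_measure refl]\<close>)
  moreover have "integral\<^sup>L (graph_measure T) f = (LBINT y:{0..1}. f (T y, y))"
    unfolding graph_measure_def by (subst integral_distr[OF g fm]) (rule lebesgue_D_integral)
  ultimately show ?thesis by simp
qed

text \<open>
  A test function is only controlled on the square; cut off to zero outside, it becomes a bounded Borel
  function on the plane.
\<close>

lemma continuous_on_square_extension:
  fixes \<alpha> :: "real \<times> real \<Rightarrow> real"
  assumes "continuous_on (D \<times> D) \<alpha>"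
  shows "(\<lambda>p. indicator (D \<times> D) p * \<alpha> p) \<in> borel_measurable borel"
    "\<exists>B. \<forall>p. \<bar>indicator (D \<times> D) p * \<alpha> p\<bar> \<le> B"
proof -
  show "(\<lambda>p. indicator (D \<times> D) p * \<alpha> p) \<in> borel_measurable borel"
    using borel_measurable_continuous_on_indicator[OF DD_borel assms] by simp
  have "compact (D \<times> D)" by (simp add: D_def compact_Times)
  then have "bounded (\<alpha> ` (D \<times> D))"
    using assms compact_continuous_image compact_imp_bounded by blast
  then obtain B where "\<And>p. p \<in> D \<times> D \<Longrightarrow> \<bar>\<alpha> p\<bar> \<le> B" by (auto simp: bounded_iff)
  then show "\<exists>B. \<forall>p. \<bar>indicator (D \<times> D) p * \<alpha> p\<bar> \<le> B"
    by (intro exI[of _ "max B 0"]) (auto simp: indicator_def le_max_iff_disj)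
qed

lemma graph_measure_integral:
  fixes \<alpha> :: "real \<times> real \<Rightarrow> real"
  assumes T: "T \<in> borel_measurable borel" and TD: "T \<in> D \<rightarrow> D"
    and \<alpha>: "continuous_on (D \<times> D) \<alpha>"
  shows "integrable (graph_measure T) \<alpha> \<and>
    integral\<^sup>L (graph_measure T) \<alpha> = (LBINT y:{0..1}. indicator (D \<times> D) (T y, y) * \<alpha> (T y, y))"
proof -
  let ?f = "\<lambda>p. indicator (D \<times> D) p * \<alpha> p"
  obtain B where B: "\<And>p. \<bar>?f p\<bar> \<le> B" using continuous_on_square_extension(2)[OF \<alpha>] by blast
  have f: "integrable (graph_measure T) ?f \<and> integral\<^sup>L (graph_measure T) ?f = (LBINT y:{0..1}. ?f (T y, y))"
    by (rule graph_measure_integral_borel[OF T TD continuous_on_square_extension(1)[OF \<alpha>] B])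
  have eq: "\<alpha> p = ?f p" if "p \<in> space (graph_measure T)" for p
    using that sets_eq_imp_space_eq[OF sets_graph_measure[of T]] by simp
  have "integrable (graph_measure T) \<alpha> \<longleftrightarrow> integrable (graph_measure T) ?f"
    by (intro Bochner_Integration.integrable_cong refl eq)
  moreover have "integral\<^sup>L (graph_measure T) \<alpha> = integral\<^sup>L (graph_measure T) ?f"
    by (intro Bochner_Integration.integral_cong refl eq)
  ultimately show ?thesis using f by simp
qed

lemma mu_inf_eq: "mu_inf = graph_measure doubling"
  unfolding mu_inf_def
proof (rule measure_with_integrals_eq)
  fix \<alpha> :: "real \<times> real \<Rightarrow> real" assume \<alpha>: "continuous_on (D \<times> D) \<alpha>"
  let ?f = "\<lambda>p. indicator (D \<times> D) p * \<alpha> p"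
  obtain B where B: "\<And>p. \<bar>?f p\<bar> \<le> B" using continuous_on_square_extension(2)[OF \<alpha>] by blast
  have "(LBINT y:{0..1}. ?f (doubling y, y)) = 1/2 * (LBINT x:{0..1}. ?f (x, x/2) + ?f (x, 1/2 + x/2))"
    by (rule integral_over_doubling[OF continuous_on_square_extension(1)[OF \<alpha>] B])
  also have "(LBINT x:{0..1}. ?f (x, x/2) + ?f (x, 1/2 + x/2)) = (LBINT x:{0..1}. \<alpha> (x, x/2) + \<alpha> (x, 1/2 + x/2))"
    by (rule set_lebesgue_integral_cong) (auto simp: D_def)
  finally show "integrable (graph_measure doubling) \<alpha> \<and> integral\<^sup>L (graph_measure doubling) \<alpha>
      = 1/2 * (LBINT x:{0..1}. \<alpha> (x, x/2) + \<alpha> (x, 1/2 + x/2))"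
    using graph_measure_integral[OF doubling_measurable doubling_Pi_D \<alpha>] by simp
qed simp

lemma mu_eq:
  assumes n: "n > 0"
  shows "mu n = graph_measure (cell_map n)"
  unfolding mu_def
proof (rule measure_with_integrals_eq)
  fix \<alpha> :: "real \<times> real \<Rightarrow> real" assume \<alpha>: "continuous_on (D \<times> D) \<alpha>"
  let ?f = "\<lambda>p. indicator (D \<times> D) p * \<alpha> p"
  obtain B where B: "\<And>p. \<bar>?f p\<bar> \<le> B" using continuous_on_square_extension(2)[OF \<alpha>] by blast
  have "(LBINT y:{0..1}. ?f (cell_map n y, y)) = (\<Sum>i<n. LBINT x:{0..1 / (2 * real n)}.
       ?f (real i / real n + x, real i / (2 * real n) + x) +
       ?f ((2 * real i + 1) / (2 * real n) + x, 1/2 + real i / (2 * real n) + x))"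
    by (rule integral_over_cell_map[OF continuous_on_square_extension(1)[OF \<alpha>] B n])
  also have "\<dots> = (\<Sum>i<n. LBINT x:{0..1 / (2 * real n)}.
       \<alpha> (real i / real n + x, real i / (2 * real n) + x) +
       \<alpha> ((2 * real i + 1) / (2 * real n) + x, 1/2 + real i / (2 * real n) + x))"
  proof (intro sum.cong refl set_lebesgue_integral_cong allI impI)
    fix i x assume "i \<in> {..<n}" and x: "x \<in> {0..1 / (2 * real n)}"
    then have i: "real i + 1 \<le> real n" by auto
    have a: "real i / real n = 2 * real i / (2 * real n)" by simp
    have b: "(1::real) / 2 = real n / (2 * real n)" using n by simp
    have 1: "real i / real n + x \<le> (2 * real i + 1) / (2 * real n)"
      unfolding a using x by (simp add: add_divide_distrib)
    have 2: "(2 * real i + 1) / (2 * real n) + x \<le> (2 * real i + 2) / (2 * real n)"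
      using x by (simp add: add_divide_distrib)
    have 3: "(2 * real i + 2) / (2 * real n) \<le> 1" using i n by (simp add: field_simps)
    have 4: "1/2 + real i / (2 * real n) + x \<le> (real n + real i + 1) / (2 * real n)"
      unfolding b using x by (simp add: add_divide_distrib)
    have 5: "(real n + real i + 1) / (2 * real n) \<le> 1" using i n by (simp add: field_simps)
    have 6: "0 \<le> real i / real n" "0 \<le> real i / (2 * real n)" "0 \<le> (2 * real i + 1) / (2 * real n)" "0 \<le> x"
      using x by simp_all
    have 7: "(2 * real i + 1) / (2 * real n) \<le> (2 * real i + 2) / (2 * real n)"
      by (intro divide_right_mono) auto
    have "(real i / real n + x, real i / (2 * real n) + x) \<in> D \<times> D"
      "((2 * real i + 1) / (2 * real n) + x, 1/2 + real i / (2 * real n) + x) \<in> D \<times> D"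
      unfolding D_def mem_Times_iff fst_conv snd_conv atLeastAtMost_iff
      using 1 2 3 4 5 6 7 by (intro conjI; linarith)+
    then show "?f (real i / real n + x, real i / (2 * real n) + x) +
       ?f ((2 * real i + 1) / (2 * real n) + x, 1/2 + real i / (2 * real n) + x)
      = \<alpha> (real i / real n + x, real i / (2 * real n) + x) +
       \<alpha> ((2 * real i + 1) / (2 * real n) + x, 1/2 + real i / (2 * real n) + x)" by simp
  qed auto
  finally show "integrable (graph_measure (cell_map n)) \<alpha> \<and> integral\<^sup>L (graph_measure (cell_map n)) \<alpha> = (\<Sum>i<n. LBINT x:{0..1 / (2 * real n)}.
       \<alpha> (real i / real n + x, real i / (2 * real n) + x) +
       \<alpha> ((2 * real i + 1) / (2 * real n) + x, 1/2 + real i / (2 * real n) + x))"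
    using graph_measure_integral[OF cell_map_measurable cell_map_Pi_D \<alpha>, of n] by simp
qed simp

lemma bistochastic_mu_inf: "bistochastic mu_inf"
  unfolding mu_inf_eq
proof (rule bistochastic_graph_measure[OF doubling_measurable doubling_Pi_D])
  fix h :: "real \<Rightarrow> real" assume h[measurable]: "h \<in> borel_measurable borel" and B: "\<And>x. \<bar>h x\<bar> \<le> 1"
  have "(\<lambda>p :: real \<times> real. h (fst p)) \<in> borel_measurable borel"
    unfolding borel_prod[symmetric] by measurable
  then have "(LBINT y:{0..1}. h (doubling y)) = 1/2 * (LBINT x:{0..1}. h x + h x)"
    using integral_over_doubling[of "\<lambda>p. h (fst p)" 1] B by simp
  also have "(LBINT x:{0..1}. h x + h x) = 2 * (LBINT x:{0..1}. h x)"
    by (subst set_integral_add(2)) (auto intro!: bounded_borel_set_integrable[OF h B, of _ 0 1])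
  finally show "(LBINT y:{0..1}. h (doubling y)) = (LBINT y:{0..1}. h y)" by simp
qed

lemma bistochastic_mu:
  assumes n: "n > 0"
  shows "bistochastic (mu n)"
  unfolding mu_eq[OF n]
proof (rule bistochastic_graph_measure[OF cell_map_measurable cell_map_Pi_D])
  fix h :: "real \<Rightarrow> real" assume h[measurable]: "h \<in> borel_measurable borel" and B: "\<And>x. \<bar>h x\<bar> \<le> 1"
  have "(\<lambda>p :: real \<times> real. h (fst p)) \<in> borel_measurable borel"
    unfolding borel_prod[symmetric] by measurable
  then have "(LBINT y:{0..1}. h (cell_map n y)) = (\<Sum>i<n. LBINT x:{0..1 / (2 * real n)}.
       h (real i / real n + x) + h ((2 * real i + 1) / (2 * real n) + x))"
    using integral_over_cell_map[of "\<lambda>p. h (fst p)" 1 n] B n by simp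
  also have "\<dots> = (\<Sum>i<n. (LBINT x:{0..1 / (2 * real n)}. h (real (2 * i) / real (2 * n) + x)) +
       (LBINT x:{0..1 / (2 * real n)}. h (real (2 * i + 1) / real (2 * n) + x)))"
  proof (intro sum.cong refl)
    fix i
    have e: "real (2 * i) / real (2 * n) = real i / real n" "real (2 * i + 1) / real (2 * n) = (2 * real i + 1) / (2 * real n)"
      by simp_all
    show "(LBINT x:{0..1 / (2 * real n)}. h (real i / real n + x) + h ((2 * real i + 1) / (2 * real n) + x))
      = (LBINT x:{0..1 / (2 * real n)}. h (real (2 * i) / real (2 * n) + x)) +
       (LBINT x:{0..1 / (2 * real n)}. h (real (2 * i + 1) / real (2 * n) + x))"
      unfolding e using B
      by (intro set_integral_add(2) bounded_borel_set_integrable[where B=1 and a=0 and b="1 / (2 * real n)"]) auto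
  qed
  also have "\<dots> = (\<Sum>k<2 * n. LBINT x:{0..1 / (2 * real n)}. h (real k / real (2 * n) + x))"
    by (rule sum_lessThan_double_parity[symmetric])
  also have "\<dots> = (LBINT y:{0..1}. h y)"
    using integral_unit_interval_cells[OF h B, of "2 * n"] n by simp
  finally show "(LBINT y:{0..1}. h (cell_map n y)) = (LBINT y:{0..1}. h y)" .
qed

section \<open>Narrow convergence\<close>

lemma cell_map_near_doubling:
  assumes y: "y \<in> D" and n: "n > 0"
  shows "\<bar>cell_map n y - doubling y\<bar> \<le> 1 / (2 * real n)"
proof -
  have fl: "\<bar>t - of_int \<lfloor>2 * real n * t\<rfloor> / (2 * real n)\<bar> \<le> 1 / (2 * real n)"
    "t \<le> (of_int \<lfloor>2 * real n * t\<rfloor> + 1) / (2 * real n)" "of_int \<lfloor>2 * real n * t\<rfloor> / (2 * real n) \<le> t" for t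
  proof -
    have 1: "of_int \<lfloor>2 * real n * t\<rfloor> \<le> 2 * real n * t" "2 * real n * t \<le> of_int \<lfloor>2 * real n * t\<rfloor> + 1"
      by linarith+
    then show 2: "of_int \<lfloor>2 * real n * t\<rfloor> / (2 * real n) \<le> t" "t \<le> (of_int \<lfloor>2 * real n * t\<rfloor> + 1) / (2 * real n)"
      using n by (simp_all add: divide_le_eq le_divide_eq mult.commute)
    then show "\<bar>t - of_int \<lfloor>2 * real n * t\<rfloor> / (2 * real n)\<bar> \<le> 1 / (2 * real n)"
      by (simp add: add_divide_distrib abs_le_iff)
  qed
  have "doubling y \<le> 1" using doubling_in_D[OF y] by (simp add: D_def)
  moreover have "\<bar>y + of_int \<lfloor>2 * real n * y\<rfloor> / (2 * real n) - 2 * y\<bar> \<le> 1 / (2 * real n)"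
    using fl(1)[of y] by simp
  moreover have "\<bar>y - 1/2 + (of_int \<lfloor>2 * real n * (y - 1/2)\<rfloor> + 1) / (2 * real n) - (2 * y - 1)\<bar> \<le> 1 / (2 * real n)"
    using fl(2,3)[of "y - 1/2"] unfolding add_divide_distrib by linarith
  ultimately show ?thesis by (auto simp: cell_map_def doubling_def min_def)
qed

lemma narrowly_converges_mu: "narrowly_converges mu mu_inf"
  unfolding narrowly_converges_def
proof (intro allI impI)
  fix \<alpha> :: "real \<times> real \<Rightarrow> real" assume \<alpha>: "continuous_on (D \<times> D) \<alpha>"
  let ?f = "\<lambda>p. indicator (D \<times> D) p * \<alpha> p"
  obtain B where B: "\<And>p. \<bar>?f p\<bar> \<le> B" using continuous_on_square_extension(2)[OF \<alpha>] by blast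
  have fb: "?f \<in> borel_measurable (borel \<Otimes>\<^sub>M borel)"
    using continuous_on_square_extension(1)[OF \<alpha>] by (simp add: borel_prod)
  note [measurable] = fb
  have "(\<lambda>n. LBINT y:{0..1}. ?f (cell_map n y, y)) \<longlonglongrightarrow> (LBINT y:{0..1}. ?f (doubling y, y))"
    unfolding set_lebesgue_integral_def
  proof (rule integral_dominated_convergence[where w="\<lambda>y. indicator {0..1} y *\<^sub>R B"])
    show "(\<lambda>y. indicator {0..1} y *\<^sub>R ?f (doubling y, y)) \<in> borel_measurable lborel"
      "(\<lambda>y. indicator {0..1} y *\<^sub>R ?f (cell_map n y, y)) \<in> borel_measurable lborel" for n
      using measurable_compose[OF _ fb, of "\<lambda>y. (doubling y, y)" borel] measurable_compose[OF _ fb, of "\<lambda>y. (cell_map n y, y)" borel]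
      by auto
    have "set_integrable lborel {0..1::real} (\<lambda>_. B)"
      by (rule borel_integrable_atLeastAtMost') simp
    then show "integrable lborel (\<lambda>y::real. indicator {0..1} y *\<^sub>R B)" by (simp add: set_integrable_def)
    show "AE y in lborel. norm (indicator {0..1} y *\<^sub>R ?f (cell_map n y, y)) \<le> indicator {0..1} y *\<^sub>R B" for n
      using B by (intro AE_I2) (simp add: abs_mult mult_left_mono)
    show "AE y in lborel. (\<lambda>n. indicator {0..1} y *\<^sub>R ?f (cell_map n y, y)) \<longlonglongrightarrow> indicator {0..1} y *\<^sub>R ?f (doubling y, y)"
    proof (rule AE_I2, rule tendsto_scaleR[OF tendsto_const])
      fix y :: real
      show "(\<lambda>n. ?f (cell_map n y, y)) \<longlonglongrightarrow> ?f (doubling y, y)"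
      proof (cases "y \<in> D")
        case True
        have "(\<lambda>n. cell_map n y - doubling y) \<longlonglongrightarrow> 0"
        proof (rule Lim_null_comparison)
          show "\<forall>\<^sub>F n in sequentially. norm (cell_map n y - doubling y) \<le> inverse (real n)"
            using eventually_gt_at_top[of 0]
          proof eventually_elim
            case (elim n)
            have "1 / (2 * real n) \<le> inverse (real n)" using elim by (simp add: field_simps)
            then show ?case using cell_map_near_doubling[OF True elim] by simp
          qed
          show "(\<lambda>n. inverse (real n)) \<longlonglongrightarrow> 0" by (rule lim_inverse_n)
        qed
        then have "(\<lambda>n. cell_map n y) \<longlonglongrightarrow> doubling y" by (simp add: LIM_zero_iff)
        then have "(\<lambda>n. (cell_map n y, y)) \<longlonglongrightarrow> (doubling y, y)" by (intro tendsto_Pair tendsto_const)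
        then have "(\<lambda>n. \<alpha> (cell_map n y, y)) \<longlonglongrightarrow> \<alpha> (doubling y, y)"
          using True cell_map_in_D doubling_in_D by (intro continuous_on_tendsto_compose[OF \<alpha>]) auto
        then show ?thesis using True cell_map_in_D doubling_in_D by simp
      qed simp
    qed
  qed
  then have "(\<lambda>n. LBINT y:{0..1}. ?f (cell_map n y, y)) \<longlonglongrightarrow> integral\<^sup>L mu_inf \<alpha>"
    using graph_measure_integral[OF doubling_measurable doubling_Pi_D \<alpha>] by (simp add: mu_inf_eq)
  moreover have "\<forall>\<^sub>F n in sequentially. (LBINT y:{0..1}. ?f (cell_map n y, y)) = integral\<^sup>L (mu n) \<alpha>"
    using eventually_gt_at_top[of 0]
  proof eventually_elim
    case (elim n)
    then show ?case using graph_measure_integral[OF cell_map_measurable cell_map_Pi_D \<alpha>, of n] by (simp add: mu_eq)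
  qed
  ultimately show "(\<lambda>n. integral\<^sup>L (mu n) \<alpha>) \<longlonglongrightarrow> integral\<^sup>L mu_inf \<alpha>"
    by (rule Lim_transform_eventually)
qed

section \<open>Evaluation of paths and measurability\<close>

lemma mtopology_of_submetric_D: "mtopology_of (submetric euclidean_metric D) = top_of_set D"
  by (simp add: mtopology_of_submetric)

lemma path_metric_eval:
  assumes t: "t \<in> {0..1}"
  shows "continuous_map (mtopology_of path_metric) (top_of_set D) (\<lambda>\<omega>. \<omega> t)"
proof -
  have "Lipschitz_continuous_map path_metric (submetric euclidean_metric D) (\<lambda>\<omega>. \<omega> t)"
    unfolding Lipschitz_continuous_map_def
  proof (intro conjI exI[of _ 1] ballI allI impI)
    show "(\<lambda>\<omega>. \<omega> t) \<in> mspace path_metric \<rightarrow> mspace (submetric euclidean_metric D)"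
      using t by (auto simp: path_metric_def Pi_iff)
    fix f g assume "f \<in> mspace path_metric" "g \<in> mspace path_metric"
    then show "mdist (submetric euclidean_metric D) (f t) (g t) \<le> 1 * mdist path_metric f g"
      unfolding path_metric_def
      using mdist_cfunspace_imp_mdist_le[of f "top_of_set {0..1}" "submetric euclidean_metric D" g _ t] t by simp
  qed
  then have "continuous_map (mtopology_of path_metric) (mtopology_of (submetric euclidean_metric D)) (\<lambda>\<omega>. \<omega> t)"
    by (rule Lipschitz_continuous_imp_continuous_map)
  then show ?thesis by (simp only: mtopology_of_submetric_D)
qed

lemma marked_path_eval:
  assumes t: "t \<in> {0..1}"
  shows "continuous_map marked_path_topology (top_of_set D) (\<lambda>(a, \<omega>). \<omega> t)"
    and "continuous_map marked_path_topology (prod_topology (top_of_set D) (top_of_set D)) (\<lambda>(a, \<omega>). (a, \<omega> t))"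
proof -
  have f: "continuous_map marked_path_topology (top_of_set D) fst"
    unfolding marked_path_topology_def by (rule continuous_map_fst)
  have "continuous_map marked_path_topology (top_of_set D) ((\<lambda>\<omega>. \<omega> t) \<circ> snd)"
    unfolding marked_path_topology_def by (rule continuous_map_compose[OF continuous_map_snd path_metric_eval[OF t]])
  then show s: "continuous_map marked_path_topology (top_of_set D) (\<lambda>(a, \<omega>). \<omega> t)"
    by (simp add: comp_def case_prod_beta')
  show "continuous_map marked_path_topology (prod_topology (top_of_set D) (top_of_set D)) (\<lambda>(a, \<omega>). (a, \<omega> t))"
    using f s unfolding case_prod_beta' by (intro continuous_map_paired[THEN iffD2] conjI)
qed

lemma sets_borel_of_topology: "openin T U \<Longrightarrow> U \<in> sets (borel_of_topology T)"
proof -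
  assume "openin T U"
  moreover have "{U. openin T U} \<subseteq> Pow (topspace T)" by (auto dest: openin_subset)
  ultimately show ?thesis
    unfolding borel_of_topology_def by (auto simp: sets_measure_of intro: sigma_sets.Basic)
qed

lemma space_borel_of_topology [simp]: "space (borel_of_topology T) = topspace T"
  unfolding borel_of_topology_def by (rule space_measure_of) (auto dest: openin_subset)

lemma continuous_map_measurable_borel:
  fixes f :: "'a \<Rightarrow> 'b::topological_space"
  assumes f: "continuous_map T (top_of_set A) f"
  shows "f \<in> measurable (borel_of_topology T) (restrict_space borel A)"
proof -
  have "f \<in> borel_measurable (borel_of_topology T)"
  proof (rule borel_measurableI)
    fix U :: "'b set" assume "open U"
    then have "openin T {x \<in> topspace T. f x \<in> U}"
      using continuous_map_into_fulltopology[OF f] openin_continuous_map_preimage by fastforce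
    moreover have "f -` U \<inter> space (borel_of_topology T) = {x \<in> topspace T. f x \<in> U}" by auto
    ultimately show "f -` U \<inter> space (borel_of_topology T) \<in> sets (borel_of_topology T)"
      by (simp add: sets_borel_of_topology)
  qed
  moreover have "f \<in> space (borel_of_topology T) \<rightarrow> A"
    using f by (auto simp: continuous_map_def)
  ultimately show ?thesis by (intro measurable_restrict_space2) auto
qed

lemma top_of_set_square: "prod_topology (top_of_set D) (top_of_set D) = top_of_set (D \<times> D)"
  by (simp add: subtopology_Times[symmetric])

lemma flow_eval_measurable:
  assumes H: "flow H" and t: "t \<in> {0..1}"
  shows "(\<lambda>(a, \<omega>). \<omega> t) \<in> measurable H lebesgue_D"
    and "(\<lambda>(a, \<omega>). (a, \<omega> t)) \<in> measurable H borel_square"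
proof -
  have sH: "sets H = sets (borel_of_topology marked_path_topology)" using H by (simp add: flow_def)
  show "(\<lambda>(a, \<omega>). \<omega> t) \<in> measurable H lebesgue_D"
    unfolding measurable_cong_sets[OF sH sets_lebesgue_D]
    by (rule continuous_map_measurable_borel[OF marked_path_eval(1)[OF t]])
  show "(\<lambda>(a, \<omega>). (a, \<omega> t)) \<in> measurable H borel_square"
    unfolding measurable_cong_sets[OF sH refl] borel_square_def
    by (rule continuous_map_measurable_borel[OF marked_path_eval(2)[OF t, unfolded top_of_set_square]])
qed

section \<open>The flow of constant paths\<close>

text \<open>
  The path that rests at \<open>x\<close>, as an element of the path space: it is \<open>undefined\<close> outside \<open>[0,1]\<close>.
\<close>

definition constant_path :: "real \<Rightarrow> real \<Rightarrow> real" where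
  "constant_path x = restrict (\<lambda>_. x) {0..1}"

lemma path_action_constant: "path_action (constant_path x) = 0"
proof -
  have ac: "absolutely_continuous_fun 0 1 (constant_path x)"
    unfolding absolutely_continuous_fun_def
  proof (intro allI impI exI[of _ 1] conjI)
    fix \<epsilon> :: real and I :: "(real \<times> real) set"
    assume e: "\<epsilon> > 0" and I: "\<forall>(u, v)\<in>I. 0 \<le> u \<and> u \<le> v \<and> v \<le> 1"
    have "(\<Sum>(u, v)\<in>I. \<bar>constant_path x v - constant_path x u\<bar>) = (\<Sum>p\<in>I. 0)"
      using I by (intro sum.cong) (auto simp: constant_path_def)
    then show "(\<Sum>(u, v)\<in>I. \<bar>constant_path x v - constant_path x u\<bar>) < \<epsilon>" using e by simp
  qed simp
  have d: "deriv (constant_path x) t = 0" if "0 < t" "t < 1" for t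
  proof -
    have "((\<lambda>_. x) has_real_derivative 0) (at t)" by simp
    then have "(constant_path x has_real_derivative 0) (at t)"
      by (rule has_field_derivative_transform_within_open[of _ _ _ "{0<..<1}"])
        (use that in \<open>auto simp: constant_path_def\<close>)
    then show ?thesis by (rule DERIV_imp_deriv)
  qed
  have "AE t in lborel. t \<noteq> (0::real)" by (rule AE_lborel_singleton)
  moreover have "AE t in lborel. t \<noteq> (1::real)" by (rule AE_lborel_singleton)
  ultimately have "AE t in lborel. ennreal (1/2 * \<bar>deriv (constant_path x) t\<bar>\<^sup>2) * indicator {0..1} t = 0"
  proof eventually_elim
    case (elim t)
    show ?case
    proof (cases "0 < t \<and> t < 1")
      case True
      then show ?thesis using d by simp
    next
      case False
      then have "t \<notin> {0..1}" using elim by auto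
      then show ?thesis by simp
    qed
  qed
  then have "(\<integral>\<^sup>+ t\<in>{0..1}. ennreal (1/2 * \<bar>deriv (constant_path x) t\<bar>\<^sup>2) \<partial>lborel) = (\<integral>\<^sup>+ t. 0 \<partial>(lborel :: real measure))"
    by (rule nn_integral_cong_AE)
  then show ?thesis using ac by (simp add: path_action_def)
qed

lemma constant_path_continuous:
  "continuous_map (top_of_set D) (mtopology_of path_metric) constant_path"
proof -
  have mem: "constant_path x \<in> mspace path_metric" if "x \<in> D" for x
  proof -
    have "continuous_map (top_of_set {0..1}) (mtopology_of (submetric euclidean_metric D)) (constant_path x)"
      unfolding mtopology_of_submetric_D
      by (rule continuous_map_eq[of _ _ "\<lambda>_. x"]) (use that in \<open>auto simp: constant_path_def\<close>)
    then show ?thesis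
      using that unfolding path_metric_def
      by (subst compactin_mspace_cfunspace) (auto simp: constant_path_def)
  qed
  have "Lipschitz_continuous_map (submetric euclidean_metric D) path_metric constant_path"
    unfolding Lipschitz_continuous_map_def
  proof (intro conjI exI[of _ 1] ballI allI impI)
    show "constant_path \<in> mspace (submetric euclidean_metric D) \<rightarrow> mspace path_metric"
      using mem by auto
    fix x y
    show "mdist path_metric (constant_path x) (constant_path y) \<le> 1 * mdist (submetric euclidean_metric D) x y"
      unfolding path_metric_def by (rule mdist_cfunspace_le) (auto simp: constant_path_def)
  qed
  then have "continuous_map (mtopology_of (submetric euclidean_metric D)) (mtopology_of path_metric) constant_path"
    by (rule Lipschitz_continuous_imp_continuous_map)
  then show ?thesis by (simp only: mtopology_of_submetric_D)
qed

text \<open>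
  The integral of the action is computed by changing the action on a null set, which does not require it
  to be measurable: the set of nonconstant paths is open, being a union over \<open>t\<close> of the conditions
  \<open>\<omega> t \<noteq> \<omega> 0\<close>, and the flow of constant paths gives it measure \<open>0\<close>.
\<close>

lemma optimal_action_mu_inf_self: "optimal_action mu_inf mu_inf = 0"
proof -
  let ?B = "borel_of_topology marked_path_topology"
  let ?c = "\<lambda>(a, x). (a, constant_path x)"
  have smu: "sets mu_inf = sets borel_square" by (simp add: mu_inf_eq)
  have spmu: "space mu_inf = D \<times> D" using sets_eq_imp_space_eq[OF smu] by simp
  have cont: "continuous_map (top_of_set (D \<times> D)) marked_path_topology ?c"
    unfolding top_of_set_square[symmetric] marked_path_topology_def
    unfolding case_prod_beta'
    using continuous_map_compose[OF continuous_map_snd constant_path_continuous, of "top_of_set D"]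
    by (intro continuous_map_paired[THEN iffD2] conjI continuous_map_fst) (simp add: comp_def)
  have meas: "?c \<in> measurable mu_inf ?B"
    unfolding borel_of_topology_def
  proof (rule measurable_measure_of)
    show "{U. openin marked_path_topology U} \<subseteq> Pow (topspace marked_path_topology)"
      by (auto dest: openin_subset)
    show "?c \<in> space mu_inf \<rightarrow> topspace marked_path_topology"
      using cont by (auto simp: continuous_map_def spmu)
    fix U assume "U \<in> {U. openin marked_path_topology U}"
    then have "openin (top_of_set (D \<times> D)) {p \<in> D \<times> D. ?c p \<in> U}"
      using openin_continuous_map_preimage[OF cont, of U] by simp
    then obtain W where W: "open W" "{p \<in> D \<times> D. ?c p \<in> U} = D \<times> D \<inter> W" by (auto simp: openin_open)
    moreover have "?c -` U \<inter> space mu_inf = {p \<in> D \<times> D. ?c p \<in> U}" by (auto simp: spmu)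
    moreover have "D \<times> D \<inter> W \<in> sets mu_inf"
      unfolding smu borel_square_def using W by (subst sets_restrict_space_iff) auto
    ultimately show "?c -` U \<inter> space mu_inf \<in> sets mu_inf" by simp
  qed
  define H where "H = distr mu_inf ?B ?c"
  have flow: "flow H" by (simp add: flow_def H_def)
  have ev1: "distr H borel_square (\<lambda>(a, \<omega>). (a, \<omega> t)) = mu_inf" if t: "t \<in> {0..1}" for t
  proof -
    have m: "(\<lambda>(a, \<omega>). (a, \<omega> t)) \<in> measurable ?B borel_square"
      using flow_eval_measurable(2)[of ?B t] t by (simp add: flow_def)
    have "distr H borel_square (\<lambda>(a, \<omega>). (a, \<omega> t)) = distr mu_inf borel_square (\<lambda>p. p)"
      unfolding H_def distr_distr[OF m meas] using t
      by (intro distr_cong) (auto simp: constant_path_def)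
    also have "\<dots> = mu_inf" by (rule distr_id2[OF smu[symmetric]])
    finally show ?thesis .
  qed
  have ev2: "distr H lebesgue_D (\<lambda>(a, \<omega>). \<omega> t) = lebesgue_D" if t: "t \<in> {0..1}" for t
  proof -
    have m: "(\<lambda>(a, \<omega>). \<omega> t) \<in> measurable ?B lebesgue_D"
      using flow_eval_measurable(1)[of ?B t] t by (simp add: flow_def)
    have "distr H lebesgue_D (\<lambda>(a, \<omega>). \<omega> t) = distr mu_inf lebesgue_D snd"
      unfolding H_def distr_distr[OF m meas] using t
      by (intro distr_cong) (auto simp: constant_path_def)
    also have "\<dots> = lebesgue_D" using bistochastic_mu_inf by (simp add: bistochastic_def)
    finally show ?thesis .
  qed
  define N where "N = (\<Union>t\<in>{0..1}. {p \<in> topspace marked_path_topology. (case p of (a, \<omega>) \<Rightarrow> \<omega> t - \<omega> 0) \<in> - {0}})"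
  have "openin marked_path_topology N"
    unfolding N_def
  proof (rule openin_clauses(3), safe)
    fix t :: real assume t: "t \<in> {0..1}"
    have "continuous_map marked_path_topology euclideanreal (\<lambda>p. (case p of (a, \<omega>) \<Rightarrow> \<omega> t) - (case p of (a, \<omega>) \<Rightarrow> \<omega> 0))"
      using t by (intro continuous_map_diff continuous_map_into_fulltopology[OF marked_path_eval(1)]) auto
    then have c: "continuous_map marked_path_topology euclideanreal (\<lambda>p. case p of (a, \<omega>) \<Rightarrow> \<omega> t - \<omega> 0)"
      by (simp add: split_beta)
    have "openin euclideanreal (- {0})" by auto
    from openin_continuous_map_preimage[OF c this]
    show "openin marked_path_topology {p \<in> topspace marked_path_topology. (case p of (a, \<omega>) \<Rightarrow> \<omega> t - \<omega> 0) \<in> - {0}}" .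
  qed
  then have N: "N \<in> sets ?B" by (rule sets_borel_of_topology)
  have "emeasure H N = 0"
  proof -
    have "?c -` N \<inter> space mu_inf = {}" by (auto simp: N_def constant_path_def)
    then show ?thesis unfolding H_def by (simp add: emeasure_distr[OF meas N])
  qed
  then have "N \<in> null_sets H" using N by (simp add: null_sets_def H_def)
  then have "AE p in H. (case p of (a, \<omega>) \<Rightarrow> path_action \<omega>) = 0"
  proof (rule AE_I')
    show "{p \<in> space H. (case p of (a, \<omega>) \<Rightarrow> path_action \<omega>) \<noteq> 0} \<subseteq> N"
    proof safe
      fix a \<omega> assume p: "(a, \<omega>) \<in> space H" and nz: "path_action \<omega> \<noteq> 0"
      have top: "(a, \<omega>) \<in> topspace marked_path_topology" using p by (simp add: H_def)
      then have "\<omega> \<in> mspace path_metric" by (simp add: marked_path_topology_def)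
      then have ext: "\<omega> \<in> extensional {0..1}" by (simp add: path_metric_def)
      have "\<exists>t\<in>{0..1}. \<omega> t \<noteq> \<omega> 0"
      proof (rule ccontr)
        assume none: "\<not> (\<exists>t\<in>{0..1}. \<omega> t \<noteq> \<omega> 0)"
        have "\<omega> = constant_path (\<omega> 0)"
          unfolding constant_path_def
        proof (rule extensionalityI[OF ext restrict_extensional])
          fix t :: real assume t: "t \<in> {0..1}"
          then have "\<omega> t = \<omega> 0" using none by blast
          also have "\<dots> = restrict (\<lambda>_. \<omega> 0) {0..1} t" by (rule restrict_apply'[OF t, symmetric])
          finally show "\<omega> t = restrict (\<lambda>_. \<omega> 0) {0..1} t" .
        qed
        then have "path_action \<omega> = path_action (constant_path (\<omega> 0))" by (rule arg_cong)
        also have "\<dots> = 0" by (rule path_action_constant)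
        finally show False using nz by contradiction
      qed
      then obtain t where t: "t \<in> {0..1}" "\<omega> t \<noteq> \<omega> 0" by blast
      have "(a, \<omega>) \<in> {p \<in> topspace marked_path_topology. (case p of (a, \<omega>) \<Rightarrow> \<omega> t - \<omega> 0) \<in> - {0}}"
        using top t(2) by simp
      then show "(a, \<omega>) \<in> N" unfolding N_def using t(1) by blast
    qed
  qed
  then have "flow_action H = (\<integral>\<^sup>+ p. 0 \<partial>H)"
    unfolding flow_action_def by (rule nn_integral_cong_AE)
  then have fa: "flow_action H = 0" by simp
  have "admissible mu_inf mu_inf H"
    unfolding admissible_def using flow ev1 ev2 fa by simp
  then have "optimal_action mu_inf mu_inf \<le> flow_action H"
    unfolding optimal_action_def by (intro INF_lower) simp
  then show ?thesis using fa by simp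
qed

section \<open>The lower bound for the action\<close>

text \<open>
  The mark \<open>a\<close> lies in the left half of its cell of length \<open>1/n\<close>.
\<close>

definition left_cell :: "nat \<Rightarrow> real \<Rightarrow> bool" where
  "left_cell n a \<longleftrightarrow> frac (real n * a) < 1/2"

lemma left_cell_iff:
  assumes "real n * r = of_int i + s" "0 \<le> s" "s < 1"
  shows "left_cell n r \<longleftrightarrow> s < 1/2"
proof -
  have "\<lfloor>real n * r\<rfloor> = i"
    using assms by (intro floor_unique) auto
  then show ?thesis using assms(1) by (simp add: left_cell_def frac_def)
qed

text \<open>
  Under \<open>mu n\<close> the half of the cell that contains the mark determines the half of \<open>D\<close> that contains the
  target.
\<close>

lemma left_cell_cell_map:
  assumes n: "n > 0" and y: "0 \<le> y" "y < 1"
  shows "left_cell n (cell_map n y) \<longleftrightarrow> y < 1/2"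
proof -
  \<comment> \<open>\<open>t\<close> is the position of \<open>y\<close> in its half of \<open>[0,1)\<close>, and \<open>i\<close> the number of its cell there.\<close>
  define t where "t = (if y < 1/2 then y else y - 1/2)"
  define e :: real where "e = (if y < 1/2 then 0 else 1/2)"
  define z where "z = 2 * real n * t"
  define i where "i = \<lfloor>z\<rfloor>"
  define s where "s = (z - of_int i) / 2 + e"
  have i: "of_int i \<le> z" "z < of_int i + 1"
    unfolding i_def by linarith+
  have "2 * t < 1" using y by (simp add: t_def)
  then have "z < real n"
    using n mult_strict_left_mono[of "2 * t" 1 "real n"] by (simp add: z_def mult.assoc mult.left_commute)
  then have "i < int n" using i(1) by linarith
  then have in1: "of_int i + 1 \<le> real n" by linarith
  have e: "e = 0 \<or> e = 1/2" by (simp add: e_def)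
  then have s: "0 \<le> s" "s < 1" "s < 1/2 \<longleftrightarrow> e = 0"    using i unfolding s_def by (elim disjE; simp add: field_simps)+
  define r where "r = t + of_int i / (2 * real n) + e / real n"
  have nr: "real n * r = of_int i + s"
    using n by (simp add: r_def s_def z_def field_simps)
  then have "real n * r < real n" using s in1 by linarith
  then have "r < 1" using n by simp
  moreover have "cell_map n y = min 1 r"
    using n by (auto simp: cell_map_def r_def t_def e_def i_def z_def field_simps)
  ultimately have "cell_map n y = r" by simp
  then show ?thesis using left_cell_iff[OF nr s(1,2)] s(3) by (simp add: e_def)
qed

lemma left_cell_measurable [measurable]: "Measurable.pred borel (left_cell n)"
  unfolding left_cell_def frac_def by measurable

text \<open>
  The pairs \<open>(a, x)\<close> of a mark and a starting point such that \<open>mu n\<close> sends the mark to the half of \<open>D\<close>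
  that does not contain \<open>x\<close>.
\<close>

definition swapped :: "nat \<Rightarrow> (real \<times> real) set" where
  "swapped n = {(a, x). (x < 1/2) \<noteq> left_cell n a}"

lemma swapped_borel [measurable]: "swapped n \<in> sets borel"
proof -
  have "{p \<in> space (borel \<Otimes>\<^sub>M borel). (snd p < (1/2 :: real)) \<noteq> left_cell n (fst p)} \<in> sets (borel \<Otimes>\<^sub>M borel)"
    by measurable
  then show ?thesis unfolding borel_prod by (simp add: swapped_def case_prod_beta')
qed

text \<open>
  Of the two equally likely starting points \<open>a/2\<close> and \<open>1/2 + a/2\<close>, exactly one is in the wrong half.
\<close>

lemma emeasure_swapped: "emeasure mu_inf (swapped n \<inter> (D \<times> D)) = ennreal (1/2)"
proof -
  have sp: "space mu_inf = D \<times> D"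
    using sets_eq_imp_space_eq[OF sets_graph_measure[of doubling]] by (simp add: mu_inf_eq)
  have B: "\<bar>indicator (swapped n) p :: real\<bar> \<le> 1" for p by (simp add: indicator_def)
  have bm: "(indicator (swapped n) :: _ \<Rightarrow> real) \<in> borel_measurable borel" by measurable
  note I = graph_measure_integral_borel[OF doubling_measurable doubling_Pi_D bm B]
  have "measure mu_inf (swapped n \<inter> (D \<times> D)) = (LBINT y:{0..1}. indicator (swapped n) (doubling y, y))"
    using I by (simp add: mu_inf_eq[symmetric] sp)
  also have "\<dots> = 1/2 * (LBINT x:{0..1}. indicator (swapped n) (x, x/2) + indicator (swapped n) (x, 1/2 + x/2))"
    by (rule integral_over_doubling[OF bm B])
  also have "(LBINT x:{0..1::real}. indicator (swapped n) (x, x/2) + indicator (swapped n) (x, 1/2 + x/2)) = (LBINT x:{0..1::real}. (1 :: real))"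
  proof (rule set_lebesgue_integral_cong_AE)
    have m: "(\<lambda>x::real. (x, x / 2)) \<in> borel_measurable borel" "(\<lambda>x::real. (x, 1/2 + x/2)) \<in> borel_measurable borel"
      by (intro borel_measurable_Pair; measurable)+
    show "(\<lambda>x. indicator (swapped n) (x, x/2) + indicator (swapped n) (x, 1/2 + x/2) :: real) \<in> borel_measurable lborel"
    proof (subst measurable_lborel2, rule borel_measurable_add)
      show "(\<lambda>x. indicator (swapped n) (x, x/2) :: real) \<in> borel_measurable borel"
        by (rule measurable_compose[OF m(1) bm])
      show "(\<lambda>x. indicator (swapped n) (x, 1/2 + x/2) :: real) \<in> borel_measurable borel"
        by (rule measurable_compose[OF m(2) bm])
    qed
    show "AE x\<in>{0..1} in lborel. indicator (swapped n) (x, x/2) + indicator (swapped n) (x, 1/2 + x/2) = (1 :: real)"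
      using AE_lborel_singleton[of "1::real"] by eventually_elim (auto simp: swapped_def indicator_def)
  qed auto
  also have "(LBINT x:{0..1::real}. (1 :: real)) = 1" by (simp add: set_lebesgue_integral_def)
  finally have half: "measure mu_inf (swapped n \<inter> (D \<times> D)) = 1/2" by simp
  have fin: "emeasure mu_inf (swapped n \<inter> (D \<times> D)) \<noteq> top"
  proof -
    have "integrable mu_inf (indicator (swapped n) :: _ \<Rightarrow> real)" using I by (simp add: mu_inf_eq)
    then show ?thesis by (auto simp: integrable_indicator_iff sp)
  qed
  show ?thesis using emeasure_eq_ennreal_measure[OF fin] unfolding half .
qed

text \<open>
  The point \<open>y = 1\<close>, at which \<open>cell_map\<close> is truncated, is null and need not be checked.
\<close>

lemma AE_graph_measureI:
  assumes T: "T \<in> borel_measurable borel" and TD: "T \<in> D \<rightarrow> D"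
    and Q: "{p. Q p} \<in> sets borel" and *: "\<And>y. y \<in> D \<Longrightarrow> y \<noteq> 1 \<Longrightarrow> Q (T y, y)"
  shows "AE p in graph_measure T. Q p"
proof -
  note g = graph_measurable[OF T TD]
  have "{p \<in> space borel_square. Q p} \<in> sets borel_square"
  proof -
    have "{p \<in> D \<times> D. Q p} = {p. Q p} \<inter> (D \<times> D)" by auto
    then show ?thesis using Q by (simp add: borel_square_def sets_restrict_space_iff space_restrict_space)
  qed
  then have "(AE p in graph_measure T. Q p) \<longleftrightarrow> (AE y in lebesgue_D. Q (T y, y))"
    unfolding graph_measure_def by (rule AE_distr_iff[OF g])
  moreover have "AE y in lebesgue_D. Q (T y, y)"
    unfolding lebesgue_D_def
    by (subst AE_restrict_space_iff) (use AE_lborel_singleton[of "1::real"] in \<open>auto elim!: eventually_mono intro: *\<close>)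
  ultimately show ?thesis by simp
qed

text \<open>
  Almost sure properties of the law of \<open>(a, \<omega> t)\<close> hold almost everywhere under the flow.
\<close>

lemma AE_admissible_endpoint:
  assumes H: "flow H" and t: "t \<in> {0..1}" and d: "distr H borel_square (\<lambda>(a, \<omega>). (a, \<omega> t)) = M"
    and AE: "AE p in M. Q p"
  shows "AE p in H. Q (fst p, snd p t)"
proof -
  have "AE p in distr H borel_square (\<lambda>(a, \<omega>). (a, \<omega> t)). Q p" using AE by (simp only: d)
  then have "AE p in H. Q ((\<lambda>(a, \<omega>). (a, \<omega> t)) p)"
    by (rule AE_distrD[OF flow_eval_measurable(2)[OF H t]])
  then show ?thesis by (simp add: case_prod_beta')
qed

lemma flow_action_lower_bound:
  assumes H: "admissible mu_inf (mu n) H" and n: "n > 0"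
  shows "ennreal (1/4 * (1/2 - 1 / (4 * real n))\<^sup>2) \<le> flow_action H"
proof -
  define c where "c = 1/2 * (1/2 - 1 / (4 * real n))\<^sup>2"
  have fl: "flow H" and d0: "distr H borel_square (\<lambda>(a, \<omega>). (a, \<omega> 0)) = mu_inf"
    and d1: "distr H borel_square (\<lambda>(a, \<omega>). (a, \<omega> 1)) = mu n"
    using H by (auto simp: admissible_def)
  have m0: "(\<lambda>(a, \<omega>). (a, \<omega> 0)) \<in> measurable H borel_square"
    by (rule flow_eval_measurable(2)[OF fl]) simp
  have "AE p in mu_inf. doubling (snd p) = fst p"
    unfolding mu_inf_eq
  proof (rule AE_graph_measureI[OF doubling_measurable doubling_Pi_D])
    have "{p \<in> space (borel \<Otimes>\<^sub>M borel). doubling (snd p) = fst p} \<in> sets (borel \<Otimes>\<^sub>M borel)" by measurable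
    then show "{p. doubling (snd p) = fst p} \<in> sets borel" unfolding borel_prod by simp
  qed simp
  then have start: "AE p in H. doubling (snd (fst p, snd p 0)) = fst (fst p, snd p (0::real))"
    using AE_admissible_endpoint[OF fl _ d0, of "\<lambda>p. doubling (snd p) = fst p"] by simp
  have "AE p in mu n. \<bar>fst p - doubling (snd p)\<bar> \<le> 1 / (2 * real n) \<and> (left_cell n (fst p) \<longleftrightarrow> snd p < 1/2)"
    unfolding mu_eq[OF n]
  proof (rule AE_graph_measureI[OF cell_map_measurable cell_map_Pi_D])
    have "{p \<in> space (borel \<Otimes>\<^sub>M borel). \<bar>fst p - doubling (snd p)\<bar> \<le> 1 / (2 * real n) \<and> (left_cell n (fst p) \<longleftrightarrow> snd p < 1/2)} \<in> sets (borel \<Otimes>\<^sub>M borel)" by measurable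
    then show "{p. \<bar>fst p - doubling (snd p)\<bar> \<le> 1 / (2 * real n) \<and> (left_cell n (fst p) \<longleftrightarrow> snd p < 1/2)} \<in> sets borel" unfolding borel_prod by simp
    fix y assume "y \<in> D" "y \<noteq> 1"
    then show "\<bar>fst (cell_map n y, y) - doubling (snd (cell_map n y, y))\<bar> \<le> 1 / (2 * real n) \<and> (left_cell n (fst (cell_map n y, y)) \<longleftrightarrow> snd (cell_map n y, y) < 1/2)"
      using cell_map_near_doubling[OF _ n] left_cell_cell_map[OF n, of y] by (simp add: D_def)
  qed
  then have target: "AE p in H. \<bar>fst (fst p, snd p 1) - doubling (snd (fst p, snd p (1::real)))\<bar> \<le> 1 / (2 * real n) \<and>
      (left_cell n (fst (fst p, snd p 1)) \<longleftrightarrow> snd (fst p, snd p 1) < 1/2)"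
    using AE_admissible_endpoint[OF fl _ d1, of "\<lambda>p. \<bar>fst p - doubling (snd p)\<bar> \<le> 1 / (2 * real n) \<and>
      (left_cell n (fst p) \<longleftrightarrow> snd p < 1/2)"] by simp
  define E where "E = (\<lambda>(a, \<omega>). (a, \<omega> 0)) -` (swapped n \<inter> (D \<times> D)) \<inter> space H"
  have sw: "swapped n \<inter> (D \<times> D) \<in> sets borel_square"
    by (simp add: borel_square_def sets_restrict_space_iff)
  have E: "E \<in> sets H" unfolding E_def by (rule measurable_sets[OF m0 sw])
  have HE: "emeasure H E = ennreal (1/2)"
    using emeasure_distr[OF m0 sw] emeasure_swapped[of n] by (simp add: d0 E_def)
  have "AE p in H. ennreal c * indicator E p \<le> (case p of (a, \<omega>) \<Rightarrow> path_action \<omega>)"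
    using start target
  proof eventually_elim
    case (elim p)
    obtain a \<omega> where p: "p = (a, \<omega>)" using prod.exhaust by blast
    show ?case
    proof (cases "p \<in> E")
      case True
      then have sw: "(\<omega> 0 < 1/2) \<noteq> left_cell n a" by (simp add: E_def p swapped_def)
      have "1 / (2 * real n) = 2 * (1 / (4 * real n))" by simp
      then have d: "1/2 - 1 / (4 * real n) \<le> \<bar>\<omega> 1 - \<omega> 0\<bar>"
        using elim sw by (auto simp: p doubling_def split: if_splits)
      moreover have "0 \<le> 1/2 - 1 / (4 * real n)" using n by (simp add: field_simps)
      ultimately have "(1/2 - 1 / (4 * real n))\<^sup>2 \<le> \<bar>\<omega> 1 - \<omega> 0\<bar>\<^sup>2" by (intro power_mono)
      then have "ennreal c \<le> ennreal (1/2 * (\<omega> 1 - \<omega> 0)\<^sup>2)" by (intro ennreal_leI) (simp add: c_def)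
      also have "\<dots> \<le> path_action \<omega>" by (rule path_action_ge)
      finally show ?thesis using True by (simp add: p)
    qed simp
  qed
  then have "(\<integral>\<^sup>+p. ennreal c * indicator E p \<partial>H) \<le> flow_action H"
    unfolding flow_action_def by (rule nn_integral_mono_AE)
  moreover have "(\<integral>\<^sup>+p. ennreal c * indicator E p \<partial>H) = ennreal c * ennreal (1/2)"
    using E HE by (simp add: nn_integral_cmult_indicator)
  moreover have "ennreal c * ennreal (1/2) = ennreal (1/4 * (1/2 - 1 / (4 * real n))\<^sup>2)"
    by (subst ennreal_mult[symmetric]) (auto simp: c_def)
  ultimately show ?thesis by simp
qed

lemma optimal_action_lower_bound:
  assumes "n > 0"
  shows "ennreal (1/4 * (1/2 - 1 / (4 * real n))\<^sup>2) \<le> optimal_action mu_inf (mu n)"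
  unfolding optimal_action_def using flow_action_lower_bound[OF _ assms] by (intro INF_greatest) auto

lemma sixteenth: "(1/16 :: ennreal) = ennreal (1/16)"
  by (simp add: divide_ennreal[symmetric])

lemma liminf_optimal_action: "liminf (\<lambda>n. optimal_action mu_inf (mu n)) \<ge> 1/16"
proof -
  have "(\<lambda>n. 1 / real n) \<longlonglongrightarrow> 0" by (rule lim_1_over_n)
  then have "(\<lambda>n. 1/4 * (1/2 - 1/4 * (1 / real n))\<^sup>2) \<longlonglongrightarrow> 1/4 * (1/2 - 1/4 * 0)\<^sup>2"
    by (intro tendsto_intros)
  then have "(\<lambda>n. ennreal (1/4 * (1/2 - 1 / (4 * real n))\<^sup>2)) \<longlonglongrightarrow> ennreal (1/16)"
    by (intro tendsto_ennrealI) (simp add: power2_eq_square)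
  then have "1/16 = liminf (\<lambda>n. ennreal (1/4 * (1/2 - 1 / (4 * real n))\<^sup>2))"
    unfolding sixteenth by (intro lim_imp_Liminf[symmetric] trivial_limit_sequentially)
  also have "\<dots> \<le> liminf (\<lambda>n. optimal_action mu_inf (mu n))"
    by (rule Liminf_mono)
      (rule eventually_mono[OF eventually_gt_at_top[of 0]], rule optimal_action_lower_bound)
  finally show ?thesis .
qed

text \<open>
  The index is shifted by one because the functional that defines \<open>mu 0\<close> is zero, so that \<open>mu 0\<close> is
  not bistochastic.
\<close>

lemma not_narrowly_continuous_optimal_action: "\<not> narrowly_continuous (optimal_action mu_inf)"
proof
  assume c: "narrowly_continuous (optimal_action mu_inf)"
  have "narrowly_converges (\<lambda>n. mu (Suc n)) mu_inf"
    unfolding narrowly_converges_def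
  proof (intro allI impI)
    fix \<alpha> :: "real \<times> real \<Rightarrow> real" assume "continuous_on (D \<times> D) \<alpha>"
    then have "(\<lambda>n. integral\<^sup>L (mu n) \<alpha>) \<longlonglongrightarrow> integral\<^sup>L mu_inf \<alpha>"
      using narrowly_converges_mu unfolding narrowly_converges_def by blast
    then show "(\<lambda>n. integral\<^sup>L (mu (Suc n)) \<alpha>) \<longlonglongrightarrow> integral\<^sup>L mu_inf \<alpha>"
      by (rule LIMSEQ_Suc)
  qed
  moreover have "\<forall>n. bistochastic (mu (Suc n))" using bistochastic_mu by blast
  ultimately have "(\<lambda>n. optimal_action mu_inf (mu (Suc n))) \<longlonglongrightarrow> optimal_action mu_inf mu_inf"
    using c[unfolded narrowly_continuous_def, rule_format, of "\<lambda>n. mu (Suc n)" mu_inf] bistochastic_mu_inf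
    by blast
  then have "(\<lambda>n. optimal_action mu_inf (mu n)) \<longlonglongrightarrow> 0"
    unfolding optimal_action_mu_inf_self by (rule LIMSEQ_imp_Suc)
  then have "liminf (\<lambda>n. optimal_action mu_inf (mu n)) = 0"
    by (intro lim_imp_Liminf trivial_limit_sequentially)
  then show False using liminf_optimal_action by simp
qed

theorem mainTheorem3:
  shows "bistochastic mu_inf \<and> (\<forall>n\<ge>1. bistochastic (mu n)) \<and>
    narrowly_converges mu mu_inf \<and>
    liminf (\<lambda>n. optimal_action mu_inf (mu n)) \<ge> 1/16 \<and>
    (1/16 :: ennreal) > 0 \<and>
    0 = optimal_action mu_inf mu_inf \<and>
    \<not> narrowly_continuous (optimal_action mu_inf)"
  using bistochastic_mu_inf bistochastic_mu narrowly_converges_mu liminf_optimal_action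
    optimal_action_mu_inf_self not_narrowly_continuous_optimal_action
  by (simp add: sixteenth)

end
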